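(* Let $W_0\in\mathfrak{su}(N)$ have eigenvalues $\lambda_1(W_0),\dots,\lambda_N(W_0)$ ordered so that $|\lambda_1(W_0)|\ge\dots\ge|\lambda_N(W_0)|$, let $1\le r\le N$, and let $Y_0=\Pi_r(W_0)\in\mathfrak{u}(N)$ be the matrix obtained by unitarily diagonalizing $W_0$ and replacing $\lambda_{r+1}(W_0),\dots,\lambda_N(W_0)$ by $0$. Let $W(t)$ and $Y(t)$, $t\in[0,T]$, be the solutions of $\dot X+[P(X),X]_N=0$ with initial conditions $W(0)=W_0$ and $Y(0)=Y_0$, respectively. Then the flow of $Y$ is Lie--Poisson on the dual of $\mathfrak{u}(N)$ and isospectral, with $Y(t)\in\mathcal{O}_{\mathrm{U}(N)}(Y_0)$ for every $t\in[0,T]$. Moreover, for every $t\in[0,T]$ and every $k\in\{1,\dots,N\}$, $$|C_k(W(t))-C_k(Y(t))|=\frac{4\pi}{N}\bigl|\mathrm{Tr}(W_0^k)-\mathrm{Tr}(Y_0^k)\bigr|=\frac{4\pi}{N}\Bigl|\sum_{j=r+1}^N\lambda_j(W_0)^k\Bigr|,$$ and $$|H(W(t))-H(Y(t))|=|H(W_0)-H(Y_0)|.$$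
   Context: Let $N\ge 2$, $\hbar_N=2/\sqrt{N^2-1}$ and $[A,B]_N=\hbar_N^{-1}(AB-BA)$. $\mathfrak{u}(N)$ denotes the skew-Hermitian $N\times N$ matrices and $\mathfrak{su}(N)$ the traceless ones. Put $s=(N-1)/2$ and, for $0\le\ell\le N-1$, $-\ell\le m\le\ell$, let $T^N_{\ell,m}\in\mathbb{C}^{N\times N}$ (rows and columns indexed by $m_1,m_2\in\{-s,-s+1,\dots,s\}$) be $$(T^N_{\ell,m})_{m_1,m_2}=\sqrt{\tfrac{N}{4\pi}}\,(-1)^{s-m_1}\sqrt{2\ell+1}\begin{pmatrix}s&\ell&s\\-m_1&m&m_2\end{pmatrix}$$ (Wigner 3j-symbol). These form a basis of $\mathbb{C}^{N\times N}$, orthonormal for $\langle A,B\rangle_{F,N}=\frac{4\pi}{N}\mathrm{Tr}(A^*B)$. The discrete Laplacian $\Delta_N$ is the linear map with $\Delta_NT^N_{\ell,m}=-\ell(\ell+1)T^N_{\ell,m}$; it preserves $\mathfrak{u}(N)$ and its kernel consists of multiples of the identity. $\Delta_N^{-1}$ is its inverse on traceless matrices, extended linearly by $\Delta_N^{-1}I=0$, and $P(X)=\Delta_N^{-1}X$. The Zeitlin model is $\dot X+[P(X),X]_N=0$. The Hamiltonian is $H(X)=-\frac12\langle X,P(X)\rangle_{F,N}$ and the Casimir functions are $C_k(X)=\frac{4\pi}{N}\mathrm{Tr}(X^k)$. The co-adjoint orbit of $Y_0\in\mathfrak{u}(N)$ is $\mathcal{O}_{\mathrm{U}(N)}(Y_0)=\{RY_0R^*: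 R\in \mathrm{U}(N)\}$. A flow on $\mathfrak{u}(N)$ (identified with its dual via $\langle\cdot,\cdot\rangle_{F,N}$) is Lie--Poisson with Hamiltonian $H$ if it satisfies $\dot X+\mathrm{ad}^*_{\nabla H(X)}X=0$, where $\mathrm{ad}^*_A X=-[A,X]_N$ and $\nabla H$ is the gradient with respect to $\langle\cdot,\cdot\rangle_{F,N}$; it is isospectral if the spectrum of the solution is constant in time. *)

theory Defs
  imports "HOL-Analysis.Analysis"
begin

section \<open>Complex matrices\<close>

text \<open>
  The pointwise product and unit of the type of vectors are not the matrix product and
  the identity matrix; the latter are \<open>**\<close> and \<open>mat 1\<close>, and powers are defined accordingly.
\<close>

type_synonym 'n cmat = "((complex, 'n) vec, 'n) vec"

primrec matpow :: "('n::finite) cmat \<Rightarrow> nat \<Rightarrow> 'n cmat" where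
  "matpow A 0 = mat 1"
| "matpow A (Suc k) = A ** matpow A k"

definition ctranspose :: "('n::finite) cmat \<Rightarrow> 'n cmat" where
  "ctranspose A = (\<chi> i j. cnj (A $ j $ i))"

definition cscale :: "complex \<Rightarrow> ('n::finite) cmat \<Rightarrow> 'n cmat" where
  "cscale c A = (\<chi> i j. c * A $ i $ j)"

definition unitary :: "('n::finite) cmat \<Rightarrow> bool" where
  "unitary R \<longleftrightarrow> R ** ctranspose R = mat 1 \<and> ctranspose R ** R = mat 1"

definition skew_hermitian :: "(('n::finite) cmat) set" where
  "skew_hermitian = {A. ctranspose A = - A}"

definition traceless_skew_hermitian :: "(('n::finite) cmat) set" where
  "traceless_skew_hermitian = {A \<in> skew_hermitian. trace A = 0}"

definition spectrum :: "('n::finite) cmat \<Rightarrow> complex set" where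
  "spectrum A = {z. \<exists>v. v \<noteq> 0 \<and> A *v v = z *s v}"

definition frob :: "('n::finite) cmat \<Rightarrow> 'n cmat \<Rightarrow> complex" where
  "frob A B = complex_of_real (4 * pi / real CARD('n)) * trace (ctranspose A ** B)"

definition hbar :: "nat \<Rightarrow> real" where
  "hbar N = 2 / sqrt ((real N)\<^sup>2 - 1)"

definition bracket :: "('n::finite) cmat \<Rightarrow> 'n cmat \<Rightarrow> 'n cmat" where
  "bracket A B = inverse (hbar CARD('n)) *\<^sub>R (A ** B - B ** A)"

section \<open>Wigner 3j-symbols\<close>

text \<open>
  The 3j-symbol with upper row \<open>a b c\<close> and lower row \<open>x y z\<close>, by Racah's formula. It is zero
  unless the selection rules hold. Under these rules all arguments of \<open>rfact\<close> below are
  nonnegative integers, so that the rounding in \<open>rfact\<close> and in the sign has no effect.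
\<close>

definition rfact :: "real \<Rightarrow> real" where
  "rfact x = fact (nat \<lfloor>x\<rfloor>)"

definition alt_sign :: "real \<Rightarrow> real" where
  "alt_sign x = (- 1) powi \<lfloor>x\<rfloor>"

definition wigner3j_admissible :: "real \<Rightarrow> real \<Rightarrow> real \<Rightarrow> real \<Rightarrow> real \<Rightarrow> real \<Rightarrow> bool" where
  "wigner3j_admissible a b c x y z \<longleftrightarrow>
     2 * a \<in> \<nat> \<and> 2 * b \<in> \<nat> \<and> 2 * c \<in> \<nat> \<and> a + b + c \<in> \<int> \<and>
     a - x \<in> \<int> \<and> b - y \<in> \<int> \<and> c - z \<in> \<int> \<and>
     \<bar>x\<bar> \<le> a \<and> \<bar>y\<bar> \<le> b \<and> \<bar>z\<bar> \<le> c \<and>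
     x + y + z = 0 \<and> \<bar>a - b\<bar> \<le> c \<and> c \<le> a + b"

definition wigner3j :: "real \<Rightarrow> real \<Rightarrow> real \<Rightarrow> real \<Rightarrow> real \<Rightarrow> real \<Rightarrow> real" where
  "wigner3j a b c x y z =
    (if wigner3j_admissible a b c x y z then
       alt_sign (a - b - z)
       * sqrt (rfact (a + b - c) * rfact (a - b + c) * rfact (- a + b + c) / rfact (a + b + c + 1))
       * sqrt (rfact (a + x) * rfact (a - x) * rfact (b + y) * rfact (b - y)
               * rfact (c + z) * rfact (c - z))
       * (\<Sum>k \<in> {k::nat. 0 \<le> c - b + real k + x \<and> 0 \<le> c - a + real k - y \<and>
                       0 \<le> a + b - c - real k \<and> 0 \<le> a - x - real k \<and> 0 \<le> b - real k + y}.
            (- 1) ^ k /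
            (fact k * rfact (c - b + real k + x) * rfact (c - a + real k - y)
             * rfact (a + b - c - real k) * rfact (a - x - real k) * rfact (b - real k + y)))
     else 0)"

section \<open>The basis matrices and the discrete Laplacian\<close>

text \<open>
  The index type carries a linear order, through which its elements are matched
  increasingly with \<open>1, ..., N\<close> and with \<open>-s, -s+1, ..., s\<close>, where \<open>s = (N-1)/2\<close>.
\<close>

definition pos :: "'n::{finite,linorder} \<Rightarrow> nat" where
  "pos i = card {j. j \<le> i}"

definition spin :: "nat \<Rightarrow> real" where
  "spin N = (real N - 1) / 2"

definition weight :: "'n::{finite,linorder} \<Rightarrow> real" where
  "weight i = real (pos i) - 1 - spin CARD('n)"

definition T_mat :: "nat \<Rightarrow> int \<Rightarrow> ('n::{finite,linorder}) cmat" where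
  "T_mat l m = (\<chi> i j. complex_of_real
     (sqrt (real CARD('n) / (4 * pi)) * alt_sign (spin CARD('n) - weight i)
      * sqrt (2 * real l + 1)
      * wigner3j (spin CARD('n)) (real l) (spin CARD('n)) (- weight i) (of_int m) (weight j)))"

definition laplacian :: "('n::{finite,linorder}) cmat \<Rightarrow> 'n cmat" where
  "laplacian = (THE L. Vector_Spaces.linear cscale cscale L \<and>
     (\<forall>l m. l \<le> CARD('n) - 1 \<and> - int l \<le> m \<and> m \<le> int l \<longrightarrow>
        L (T_mat l m) = cscale (- (of_nat l * (of_nat l + 1))) (T_mat l m)))"

definition laplacian_inv :: "('n::{finite,linorder}) cmat \<Rightarrow> 'n cmat" where
  "laplacian_inv = (THE M. Vector_Spaces.linear cscale cscale M \<and> M (mat 1) = 0 \<and>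
     (\<forall>X. trace X = 0 \<longrightarrow> trace (M X) = 0 \<and> laplacian (M X) = X \<and> M (laplacian X) = X))"

section \<open>The Zeitlin model\<close>

definition zeitlin_solution ::
    "real \<Rightarrow> ('n::{finite,linorder}) cmat \<Rightarrow> (real \<Rightarrow> 'n cmat) \<Rightarrow> bool" where
  "zeitlin_solution T X0 X \<longleftrightarrow> X 0 = X0 \<and>
     (\<forall>t\<in>{0..T}. \<exists>X'. (X has_vector_derivative X') (at t within {0..T}) \<and>
        X' + bracket (laplacian_inv (X t)) (X t) = 0)"

text \<open>
  The pairing \<open>frob\<close>, and hence the Hamiltonian, is real-valued on skew-Hermitian matrices, but
  both are kept as complex-valued functions.
\<close>

definition hamiltonian :: "('n::{finite,linorder}) cmat \<Rightarrow> complex" where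
  "hamiltonian X = - (1 / 2) * frob X (laplacian_inv X)"

definition casimir :: "nat \<Rightarrow> ('n::finite) cmat \<Rightarrow> complex" where
  "casimir k X = complex_of_real (4 * pi / real CARD('n)) * trace (matpow X k)"

definition coadjoint_orbit :: "('n::finite) cmat \<Rightarrow> ('n cmat) set" where
  "coadjoint_orbit Y0 = {R ** Y0 ** ctranspose R | R. unitary R}"

definition ad_star :: "('n::finite) cmat \<Rightarrow> 'n cmat \<Rightarrow> 'n cmat" where
  "ad_star A X = - bracket A X"

text \<open>
  The gradient at \<open>X\<close> of a function on the real vector space of skew-Hermitian matrices: a
  skew-Hermitian matrix representing the derivative along this space.
\<close>

definition has_gradient ::
    "(('n::finite) cmat \<Rightarrow> complex) \<Rightarrow> 'n cmat \<Rightarrow> 'n cmat \<Rightarrow> bool" where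
  "has_gradient F X G \<longleftrightarrow> G \<in> skew_hermitian \<and>
     (F has_derivative (\<lambda>V. frob G V)) (at X within skew_hermitian)"

definition lie_poisson_on ::
    "real set \<Rightarrow> (('n::finite) cmat \<Rightarrow> complex) \<Rightarrow> (real \<Rightarrow> 'n cmat) \<Rightarrow> bool" where
  "lie_poisson_on S F X \<longleftrightarrow>
     (\<forall>t\<in>S. X t \<in> skew_hermitian) \<and>
     (\<exists>gradF. (\<forall>A\<in>skew_hermitian. has_gradient F A (gradF A)) \<and>
        (\<forall>t\<in>S. \<exists>X'. (X has_vector_derivative X') (at t within S) \<and>
           X' + ad_star (gradF (X t)) (X t) = 0))"

definition isospectral_on :: "real set \<Rightarrow> (real \<Rightarrow> ('n::finite) cmat) \<Rightarrow> bool" where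
  "isospectral_on S X \<longleftrightarrow> (\<forall>t\<in>S. \<forall>t'\<in>S. spectrum (X t) = spectrum (X t'))"

section \<open>Spectral truncation\<close>

definition diag_mat :: "(nat \<Rightarrow> complex) \<Rightarrow> ('n::{finite,linorder}) cmat" where
  "diag_mat d = (\<chi> i j. if i = j then d (pos i) else 0)"

text \<open>
  \<open>lam 1, ..., lam N\<close> are the eigenvalues of \<open>W0\<close> with multiplicity, in nonincreasing order of
  modulus, and \<open>Y0\<close> arises from a unitary diagonalization of \<open>W0\<close> by annihilating
  \<open>lam j\<close> for \<open>j > r\<close>. If \<open>lam r\<close> and \<open>lam (r + 1)\<close> have equal modulus, then \<open>Y0\<close> depends
  on the chosen diagonalization, hence a relation instead of a function.
\<close>

definition spectral_truncation ::
    "nat \<Rightarrow> (nat \<Rightarrow> complex) \<Rightarrow> ('n::{finite,linorder}) cmat \<Rightarrow> 'n cmat \<Rightarrow> bool" where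
  "spectral_truncation r lam W0 Y0 \<longleftrightarrow>
     (\<forall>i j. 1 \<le> i \<and> i \<le> j \<and> j \<le> CARD('n) \<longrightarrow> cmod (lam j) \<le> cmod (lam i)) \<and>
     (\<exists>U. unitary U \<and>
        W0 = U ** diag_mat lam ** ctranspose U \<and>
        Y0 = U ** diag_mat (\<lambda>j. if j \<le> r then lam j else 0) ** ctranspose U)"

end

theory Submission
  imports Defs
begin

text \<open>
  The Zeitlin flow moves every skew-Hermitian matrix by unitary conjugation. The equation has the
  form \<open>X' = A X - X A\<close>, where \<open>A\<close> is the multiple \<open>- P(X) / hbar\<close> of \<open>P(X)\<close>. If \<open>X\<close> is
  skew-Hermitian, then so is \<open>A\<close>; the linear equation \<open>R' = A R\<close>, \<open>R(0) = 1\<close> therefore has a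
  unitary solution \<open>R\<close>, the matrix \<open>R* X R\<close> is constant in time, and \<open>X\<close> stays in the coadjoint
  orbit of its initial value (\<open>zeitlin_solution_orbit\<close>). Unitary conjugation preserves the spectrum
  and the traces of powers, so that the differences of the Casimir functions can be evaluated at
  time \<open>0\<close>, where the truncation has removed exactly the eigenvalues \<open>lam j\<close> with \<open>j > r\<close>.
  Moreover \<open>H\<close> is a quadratic form with gradient \<open>- P(X)\<close>, which gives both the Lie--Poisson form
  and the conservation of \<open>H\<close>.

  These arguments use that \<open>P\<close>, the inverse Laplacian, is a linear map that is symmetric for the
  Frobenius pairing and commutes with the conjugate transpose. Since the Laplacian is given
  by its eigenvectors \<open>T_mat l m\<close>, whose entries are Racah sums, this is where the main work lies.
  Up to nonzero factors, the entry of \<open>T_mat l m\<close> at row \<open>i\<close> and column \<open>j\<close>, counted from \<open>0\<close>, is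
  for \<open>i - j = m\<close> the coefficient \<open>hahn l (N - 1 - l) i j\<close> of \<open>x\<^sup>i y\<^sup>j\<close> in the polynomial
  \<open>(1 - x)\<^sup>l (1 + y)\<^sup>l (1 + x y)\<^sup>b\<close> with \<open>b = N - 1 - l\<close> (\<open>T_mat_hahn_mat\<close>); the
  other entries vanish. Multiplication by
  \<open>1 + x y\<close> is a Pascal rule, by which an induction over \<open>b\<close> yields a second-order difference
  equation along the diagonals (\<open>hahn_difference\<close>). It says that \<open>T_mat l m\<close> is an eigenvector for
  the eigenvalue \<open>- l (l + 1)\<close> of the explicit operator \<open>casimir_op\<close>, the negative sum of the squared
  commutators with the spin matrices. That operator is evidently symmetric and compatible
  with the conjugate transpose. Its eigenvectors \<open>T_mat l m\<close> are thus orthogonal, they form a basis,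
  and \<open>casimir_op\<close> is the Laplacian (\<open>laplacian_eq_casimir_op\<close>).
\<close>

section \<open>The coefficients of the generating polynomial\<close>

text \<open>
  The coefficient of \<open>x\<^sup>i y\<^sup>j\<close> in \<open>(1 - x)\<^sup>l (1 + y)\<^sup>l (1 + x y)\<^sup>b\<close>, where \<open>p\<close> counts the chosen
  factors \<open>x y\<close>. Along a diagonal \<open>i - j = m\<close> these are, up to normalization, discrete
  orthogonal polynomials of Hahn type.
\<close>

definition hahn :: "nat \<Rightarrow> nat \<Rightarrow> nat \<Rightarrow> nat \<Rightarrow> real" where
  "hahn l b i j = (\<Sum>p\<le>min i j.
     (- 1) ^ (i - p) * real (b choose p) * real (l choose (i - p)) * real (l choose (j - p)))"

lemma hahn_0: "hahn l 0 i j = (- 1) ^ i * real (l choose i) * real (l choose j)"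
proof -
  have "hahn l 0 i j = (\<Sum>p\<in>{0}.
     (- 1) ^ (i - p) * real (0 choose p) * real (l choose (i - p)) * real (l choose (j - p)))"
    unfolding hahn_def by (rule sum.mono_neutral_right) (auto simp: binomial_eq_0)
  then show ?thesis by simp
qed

lemma hahn_Suc_edge:
  assumes "i = 0 \<or> j = 0"
  shows "hahn l (Suc b) i j = hahn l b i j"
  using assms by (auto simp: hahn_def)

text \<open>
  Multiplication of the generating polynomial by \<open>1 + x y\<close>.
\<close>

lemma hahn_Suc:
  "hahn l (Suc b) (Suc i) (Suc j) = hahn l b (Suc i) (Suc j) + hahn l b i j"
proof -
  define g where "g p = (- 1) ^ (i - p) * real (l choose (i - p)) * real (l choose (j - p))" for p
  have shift: "hahn l c (Suc i) (Suc j)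
      = (- 1) ^ Suc i * real (l choose Suc i) * real (l choose Suc j)
        + (\<Sum>p\<le>min i j. real (c choose Suc p) * g p)" for c
    unfolding hahn_def min_Suc_Suc sum.atMost_Suc_shift g_def by (simp add: mult_ac)
  have "hahn l b i j = (\<Sum>p\<le>min i j. real (b choose p) * g p)"
    unfolding hahn_def g_def by (simp add: mult_ac)
  then show ?thesis
    unfolding shift by (simp add: algebra_simps sum.distrib)
qed

lemma Suc_times_binomial_Suc_real:
  "(real i + 1) * real (l choose Suc i) = (real l - real i) * real (l choose i)"
proof (cases "i \<le> l")
  case True
  have "Suc i * (l choose Suc i) = (l - i) * (l choose i)"
    by (simp only: binomial_absorb_comp binomial_absorption)
  then have "real (Suc i * (l choose Suc i)) = real ((l - i) * (l choose i))"
    by (rule arg_cong)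
  then show ?thesis using True by (simp add: of_nat_diff algebra_simps)
qed (simp add: binomial_eq_0)

text \<open>
  The boundary case of the difference equation below: on the first row and the first column the
  neighbour with lower indices is absent. With \<open>b = 0\<close> the coefficients are products of
  binomial coefficients, and the Pascal rule propagates the equation to all \<open>b\<close>.
\<close>

lemma hahn_difference_edge:
  assumes "i = 0 \<or> j = 0"
  shows "(real i + 1) * (real j + 1) * hahn l b (Suc i) (Suc j)
    = (real (l + b) * (1 + real i + real j) - 2 * real i * real j - real l * (real l + 1)) * hahn l b i j"
proof (induction b)
  case 0
  have "(real i + 1) * (real j + 1) * hahn l 0 (Suc i) (Suc j)
    = - ((- 1) ^ i) * ((real i + 1) * real (l choose Suc i)) * ((real j + 1) * real (l choose Suc j))"
    by (simp add: hahn_0)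
  also have "\<dots> = - ((real l - real i) * (real l - real j)) * hahn l 0 i j"
    by (simp only: Suc_times_binomial_Suc_real hahn_0) simp
  finally show ?case using assms by (auto simp: algebra_simps)
next
  case (Suc b)
  then show ?case using assms
    by (auto simp: hahn_Suc hahn_Suc_edge algebra_simps)
qed

text \<open>
  With \<open>n = l + b\<close> and indices shifted by one, this is the eigenvalue equation
  \<open>(i+1)(j+1) F(i+1,j+1) + (n-i+1)(n-j+1) F(i-1,j-1) = (n + n(i+j) - 2ij - l(l+1)) F(i,j)\<close>.
  In the induction over \<open>b\<close>, the equation for \<open>b + 1\<close> at a point is the sum of the
  equations for \<open>b\<close> at this point and at its lower neighbour on the same diagonal.
\<close>

lemma hahn_difference:
  "(real i + 2) * (real j + 2) * hahn l b (Suc (Suc i)) (Suc (Suc j))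
     + (real (l + b) - real i) * (real (l + b) - real j) * hahn l b i j
    = (real (l + b) * (3 + real i + real j) - 2 * (real i + 1) * (real j + 1) - real l * (real l + 1))
      * hahn l b (Suc i) (Suc j)"
proof (induction b arbitrary: i j)
  case 0
  have up: "(real i + 2) * (real j + 2) * hahn l 0 (Suc (Suc i)) (Suc (Suc j))
    = - ((real l - (real i + 1)) * (real l - (real j + 1))) * hahn l 0 (Suc i) (Suc j)"
  proof -
    have "(real i + 2) * (real j + 2) * hahn l 0 (Suc (Suc i)) (Suc (Suc j))
      = (- 1) ^ i * ((real (Suc i) + 1) * real (l choose Suc (Suc i)))
         * ((real (Suc j) + 1) * real (l choose Suc (Suc j)))"
      by (simp add: hahn_0 add.commute)
    also have "\<dots> = - ((real l - (real i + 1)) * (real l - (real j + 1))) * hahn l 0 (Suc i) (Suc j)"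
      by (simp only: Suc_times_binomial_Suc_real hahn_0) (simp add: algebra_simps)
    finally show ?thesis .
  qed
  have down: "(real l - real i) * (real l - real j) * hahn l 0 i j
    = - ((real i + 1) * (real j + 1)) * hahn l 0 (Suc i) (Suc j)"
  proof -
    have "(real l - real i) * (real l - real j) * hahn l 0 i j
      = (- 1) ^ i * ((real l - real i) * real (l choose i)) * ((real l - real j) * real (l choose j))"
      by (simp add: hahn_0)
    also have "\<dots> = - ((real i + 1) * (real j + 1)) * hahn l 0 (Suc i) (Suc j)"
      by (simp only: Suc_times_binomial_Suc_real[symmetric] hahn_0) simp
    finally show ?thesis .
  qed
  show ?case using up down by (simp add: algebra_simps)
next
  case (Suc b)
  show ?case
  proof (cases "i = 0 \<or> j = 0")
    case True
    show ?thesis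
      using Suc[of i j] hahn_difference_edge[OF True, of l b] True
      unfolding hahn_Suc hahn_Suc_edge[OF True]
      by (auto simp: algebra_simps)
  next
    case False
    then obtain i' j' where ij: "i = Suc i'" "j = Suc j'" by (meson not0_implies_Suc)
    show ?thesis
      using Suc[of i j] Suc[of i' j']
      unfolding ij hahn_Suc
      by (simp add: algebra_simps)
  qed
qed

lemma hahn_eq_0:
  assumes "l + b < i \<or> l + b < j"
  shows "hahn l b i j = 0"
  unfolding hahn_def
proof (rule sum.neutral, rule ballI)
  fix p
  have "b < p \<or> l < i - p \<or> l < j - p" using assms by linarith
  then show "(- 1) ^ (i - p) * real (b choose p) * real (l choose (i - p)) * real (l choose (j - p)) = 0"
    by (auto simp: binomial_eq_0)
qed

section \<open>Evaluation of the 3j-symbols\<close>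

lemma rfact_of_nat: "rfact (real k) = fact k"
  by (simp add: rfact_def)

lemma rfact_eq: "x = real k \<Longrightarrow> rfact x = fact k"
  by (simp add: rfact_of_nat)

text \<open>
  In Racah's sum the six factorials of a summand combine in pairs with constant sums
  \<open>l\<close>, \<open>n - l\<close>, \<open>l\<close>, hence to three binomial coefficients; the substitution \<open>p = I - k\<close> turns the
  sum into the one of \<open>hahn\<close>.
\<close>

lemma wigner3j_hahn:
  fixes n l I J :: nat and m :: int
  assumes "I \<le> n" "J \<le> n" "l \<le> n" "- int l \<le> m" "m \<le> int l" and m: "m = int I - int J"
  shows "wigner3j (real n / 2) (real l) (real n / 2) (real n / 2 - real I) (of_int m) (real J - real n / 2)
    = alt_sign (real n - real l - real J)
      * sqrt (fact l * fact (n - l) * fact l / fact (n + l + 1))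
      * sqrt (fact (n - I) * fact I * rfact (real l + of_int m) * rfact (real l - of_int m) * fact J * fact (n - J))
      * (hahn l (n - l) I J / (fact (n - l) * fact l * fact l))"
proof -
  have adm: "wigner3j_admissible (real n / 2) (real l) (real n / 2) (real n / 2 - real I) (of_int m) (real J - real n / 2)"
    using assms by (auto simp: wigner3j_admissible_def abs_le_iff abs_real_def)
  define S where "S = {k::nat. 0 \<le> real n / 2 - real l + real k + (real n / 2 - real I)
    \<and> 0 \<le> real n / 2 - real n / 2 + real k - of_int m \<and> 0 \<le> real n / 2 + real l - real n / 2 - real k
    \<and> 0 \<le> real n / 2 - (real n / 2 - real I) - real k \<and> 0 \<le> real l - real k + of_int m}"
  have S: "S = {k. l + I \<le> n + k \<and> I \<le> J + k \<and> k \<le> l \<and> k \<le> I \<and> k + J \<le> l + I}"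
    unfolding S_def m by auto
  define h where "h k = (- 1) ^ k * real (l choose k) * real ((n - l) choose (I - k)) * real (l choose (J - (I - k)))
     / (fact (n - l) * fact l * fact l)" for k
  have summand: "(- 1) ^ k / (fact k * rfact (real n / 2 - real l + real k + (real n / 2 - real I))
       * rfact (real n / 2 - real n / 2 + real k - of_int m) * rfact (real n / 2 + real l - real n / 2 - real k)
       * rfact (real n / 2 - (real n / 2 - real I) - real k) * rfact (real l - real k + of_int m)) = h k"
    if "k \<in> S" for k
  proof -
    have k: "l + I \<le> n + k" "I \<le> J + k" "k \<le> l" "k \<le> I" "k + J \<le> l + I"
      using that unfolding S by auto
    have r: "rfact (real n / 2 - real l + real k + (real n / 2 - real I)) = fact ((n - l) - (I - k))"
      "rfact (real n / 2 - real n / 2 + real k - of_int m) = fact (J - (I - k))"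
      "rfact (real n / 2 + real l - real n / 2 - real k) = fact (l - k)"
      "rfact (real n / 2 - (real n / 2 - real I) - real k) = fact (I - k)"
      "rfact (real l - real k + of_int m) = fact (l - (J - (I - k)))"
      by (rule rfact_eq, use k assms in \<open>simp add: of_nat_diff\<close>)+
    have c: "I - k \<le> n - l" "J - (I - k) \<le> l" using k assms by auto
    show ?thesis
      unfolding r h_def binomial_fact[OF c(1), where ?'a = real] binomial_fact[OF c(2), where ?'a = real]
        binomial_fact[OF k(3), where ?'a = real]
      by (simp add: field_simps)
  qed
  \<comment> \<open>Outside the range of Racah's formula one of the three binomial coefficients vanishes, so the
    range may be enlarged to one that does not depend on l.\<close>
  have "(\<Sum>k\<in>S. h k) = (\<Sum>k\<in>{k. k \<le> I \<and> I \<le> J + k}. h k)"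
  proof (rule sum.mono_neutral_left)
    show "finite {k. k \<le> I \<and> I \<le> J + k}" by (rule finite_subset[of _ "{..I}"]) auto
    show "S \<subseteq> {k. k \<le> I \<and> I \<le> J + k}" unfolding S by auto
    show "\<forall>k\<in>{k. k \<le> I \<and> I \<le> J + k} - S. h k = 0"
    proof
      fix k assume "k \<in> {k. k \<le> I \<and> I \<le> J + k} - S"
      then have "l < k \<or> n - l < I - k \<or> l < J - (I - k)" using assms(3) unfolding S by auto
      then show "h k = 0" by (auto simp: h_def binomial_eq_0)
    qed
  qed
  also have "\<dots> = (\<Sum>p\<le>min I J. h (I - p))"
    by (rule sum.reindex_bij_witness[of _ "\<lambda>p. I - p" "\<lambda>k. I - k"]) auto
  also have "\<dots> = hahn l (n - l) I J / (fact (n - l) * fact l * fact l)"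
    unfolding hahn_def sum_divide_distrib
    by (rule sum.cong) (auto simp: h_def)
  finally have sum: "(\<Sum>k\<in>S. h k) = hahn l (n - l) I J / (fact (n - l) * fact l * fact l)" .
  have r: "rfact (real n / 2 + real l - real n / 2) = fact l"
    "rfact (real n / 2 - real l + real n / 2) = fact (n - l)"
    "rfact (- (real n / 2) + real l + real n / 2) = fact l"
    "rfact (real n / 2 + real l + real n / 2 + 1) = fact (n + l + 1)"
    "rfact (real n / 2 + (real n / 2 - real I)) = fact (n - I)"
    "rfact (real n / 2 - (real n / 2 - real I)) = fact I"
    "rfact (real n / 2 + (real J - real n / 2)) = fact J"
    "rfact (real n / 2 - (real J - real n / 2)) = fact (n - J)"
    by (rule rfact_eq, use assms in \<open>simp add: of_nat_diff\<close>)+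
  have a: "real n / 2 - real l - (real J - real n / 2) = real n - real l - real J" by simp
  show ?thesis
    unfolding wigner3j_def using adm sum
    by (simp only: if_True S_def[symmetric] r a summand cong: sum.cong)
qed

lemma wigner3j_eq_0: "x + y + z \<noteq> 0 \<Longrightarrow> wigner3j a b c x y z = 0"
  by (simp add: wigner3j_def wigner3j_admissible_def)

section \<open>Real matrices indexed by position and the spin operators\<close>

definition idx :: "'n::{finite,linorder} \<Rightarrow> nat" where
  "idx i = pos i - 1"

lemma bij_betw_pos: "bij_betw pos (UNIV :: 'n::{finite,linorder} set) {1..CARD('n)}"
proof -
  have less: "pos i < pos j" if "i < j" for i j :: 'n
    unfolding pos_def
  proof (rule psubset_card_mono)
    have "j \<in> {k. k \<le> j}" "j \<notin> {k. k \<le> i}" using that by auto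
    moreover have "{k. k \<le> i} \<subseteq> {k. k \<le> j}" using that by auto
    ultimately show "{k. k \<le> i} \<subset> {k. k \<le> j}" by blast
  qed simp
  have inj: "inj (pos :: 'n \<Rightarrow> nat)"
    by (rule injI) (metis less less_irrefl neqE)
  have "pos i \<in> {1..CARD('n)}" for i :: 'n
    unfolding pos_def by (auto simp: Suc_le_eq card_gt_0_iff intro!: card_mono)
  then have "pos ` (UNIV :: 'n set) \<subseteq> {1..CARD('n)}" by auto
  moreover have "card (pos ` (UNIV :: 'n set)) = card {1..CARD('n)}"
    by (simp add: card_image inj)
  ultimately have "pos ` (UNIV :: 'n set) = {1..CARD('n)}"
    by (intro card_subset_eq) auto
  with inj show ?thesis by (simp add: bij_betw_def)
qed

lemma pos_eq_Suc_idx: "pos (i :: 'n::{finite,linorder}) = Suc (idx i)"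
  using bij_betw_apply[OF bij_betw_pos UNIV_I, of i] by (simp add: idx_def)

lemma bij_betw_idx: "bij_betw idx (UNIV :: 'n::{finite,linorder} set) {..<CARD('n)}"
proof -
  have "bij_betw (\<lambda>k. k - 1) {1..CARD('n)} {..<CARD('n)}"
    by (rule bij_betw_byWitness[where f' = Suc]) auto
  from bij_betw_trans[OF bij_betw_pos this] show ?thesis
    by (simp add: o_def idx_def[abs_def])
qed

lemma idx_less: "idx (i :: 'n::{finite,linorder}) < CARD('n)"
  using bij_betwE[OF bij_betw_idx] by auto

lemma idx_eq_iff [simp]: "idx i = idx j \<longleftrightarrow> i = j"
  using bij_betw_imp_inj_on[OF bij_betw_idx] by (auto dest: injD)

lemma ex_idx: "k < CARD('n) \<Longrightarrow> \<exists>i :: 'n::{finite,linorder}. idx i = k"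
  using bij_betw_imp_surj_on[OF bij_betw_idx] by (metis imageE lessThan_iff)

lemma sum_idx: "(\<Sum>i::'n::{finite,linorder}\<in>UNIV. f (idx i)) = (\<Sum>k<CARD('n). f k)"
  by (rule sum.reindex_bij_betw[OF bij_betw_idx])

text \<open>
  All matrices of the construction have real entries that depend on the positions of row
  and column only, so that identities between them reduce to identities of functions on pairs of
  natural numbers.
\<close>

definition entries :: "(nat \<Rightarrow> nat \<Rightarrow> real) \<Rightarrow> ('n::{finite,linorder}) cmat" where
  "entries f = (\<chi> i j. complex_of_real (f (idx i) (idx j)))"

lemma entries_cong:
  "(\<And>i j. i < CARD('n) \<Longrightarrow> j < CARD('n) \<Longrightarrow> f i j = g i j) \<Longrightarrow>
    (entries f :: 'n::{finite,linorder} cmat) = entries g"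
  by (simp add: entries_def vec_eq_iff idx_less)

lemma entries_mult:
  "(entries f :: 'n::{finite,linorder} cmat) ** entries g
    = entries (\<lambda>i j. \<Sum>k<CARD('n). f i k * g k j)"
proof -
  have "(\<Sum>k\<in>(UNIV :: 'n set). complex_of_real (f (idx i) (idx k)) * complex_of_real (g (idx k) (idx j)))
     = complex_of_real (\<Sum>k<CARD('n). f (idx i) k * g k (idx j))" for i j :: 'n
    by (simp add: sum_idx[where 'n = 'n and f = "\<lambda>k. f (idx i) k * g k (idx j)", symmetric])
  then show ?thesis by (simp add: entries_def matrix_matrix_mult_def vec_eq_iff)
qed

lemma ctranspose_entries: "ctranspose (entries f) = entries (\<lambda>i j. f j i)"
  by (simp add: ctranspose_def entries_def vec_eq_iff)

lemma entries_add: "entries f + entries g = entries (\<lambda>i j. f i j + g i j)"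
  by (simp add: entries_def vec_eq_iff)

lemma entries_scaleR: "c *\<^sub>R entries f = entries (\<lambda>i j. c * f i j)"
  by (simp add: entries_def vec_eq_iff) (simp add: scaleR_conv_of_real)

text \<open>
  With \<open>s = (N - 1) / 2\<close>, these are the coefficients of the ladder operators of the spin-\<open>s\<close>
  representation: \<open>spin_shift\<close> and its transpose are the ladder operators, and \<open>spin_diag\<close> is the
  spin component that is diagonal.
\<close>

definition shift_weight :: "nat \<Rightarrow> nat \<Rightarrow> real" where
  "shift_weight N i = sqrt ((real i + 1) * (real N - 1 - real i))"

definition spin_shift :: "('n::{finite,linorder}) cmat" where
  "spin_shift = entries (\<lambda>i j. if j = Suc i then shift_weight CARD('n) i else 0)"

definition spin_diag :: "('n::{finite,linorder}) cmat" where
  "spin_diag = entries (\<lambda>i j. if i = j then real i - (real CARD('n) - 1) / 2 else 0)"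

text \<open>
  Expanding the commutators, the operator \<open>X \<mapsto> - (sum of [S, [S, X]] over the three spin matrices S)\<close>
  takes this form, because the sum of the squares of the spin matrices is the scalar
  \<open>s (s + 1) = (N\<^sup>2 - 1) / 4\<close>. In this form its symmetry is visible, and its action on
  matrix entries couples only neighbours on the same diagonal.
\<close>

definition casimir_op :: "('n::{finite,linorder}) cmat \<Rightarrow> 'n cmat" where
  "casimir_op X = 2 *\<^sub>R (spin_diag ** X ** spin_diag)
     + spin_shift ** X ** ctranspose spin_shift + ctranspose spin_shift ** X ** spin_shift
     + (- ((real CARD('n))\<^sup>2 - 1) / 2) *\<^sub>R X"

lemma shift_up_left:
  "spin_shift ** (entries f :: 'n::{finite,linorder} cmat)
    = entries (\<lambda>i j. shift_weight CARD('n) i * f (Suc i) j)"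
  unfolding spin_shift_def entries_mult
proof (rule entries_cong)
  fix i j :: nat assume "i < CARD('n)"
  then have "Suc i < CARD('n) \<or> shift_weight CARD('n) i = 0"
    by (auto simp: shift_weight_def not_less dest!: le_antisym[of "CARD('n)"] simp flip: of_nat_Suc)
  moreover have "(\<Sum>k<CARD('n). (if k = Suc i then shift_weight CARD('n) i else 0) * f k j)
    = (\<Sum>k<CARD('n). if k = Suc i then shift_weight CARD('n) i * f k j else 0)"
    by (rule sum.cong) auto
  ultimately show "(\<Sum>k<CARD('n). (if k = Suc i then shift_weight CARD('n) i else 0) * f k j)
    = shift_weight CARD('n) i * f (Suc i) j"
    by (auto simp: sum.delta)
qed

lemma shift_down_left:
  "ctranspose spin_shift ** (entries f :: 'n::{finite,linorder} cmat)
    = entries (\<lambda>i j. if i = 0 then 0 else shift_weight CARD('n) (i - 1) * f (i - 1) j)"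
  unfolding spin_shift_def ctranspose_entries entries_mult
proof (rule entries_cong)
  fix i j :: nat assume i: "i < CARD('n)"
  have "(\<Sum>k<CARD('n). (if i = Suc k then shift_weight CARD('n) k else 0) * f k j)
    = (\<Sum>k<CARD('n). if k = i - 1 then (if i = 0 then 0 else shift_weight CARD('n) (i - 1) * f (i - 1) j) else 0)"
    by (rule sum.cong) auto
  also have "\<dots> = (if i = 0 then 0 else shift_weight CARD('n) (i - 1) * f (i - 1) j)"
    using i by (subst sum.delta) auto
  finally show "(\<Sum>k<CARD('n). (if i = Suc k then shift_weight CARD('n) k else 0) * f k j) = \<dots>" .
qed

lemma diag_left:
  "spin_diag ** (entries f :: 'n::{finite,linorder} cmat)
    = entries (\<lambda>i j. (real i - (real CARD('n) - 1) / 2) * f i j)"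
  unfolding spin_diag_def entries_mult
proof (rule entries_cong)
  fix i j :: nat assume i: "i < CARD('n)"
  have "(\<Sum>k<CARD('n). (if i = k then real i - (real CARD('n) - 1) / 2 else 0) * f k j)
    = (\<Sum>k<CARD('n). if k = i then (real i - (real CARD('n) - 1) / 2) * f i j else 0)"
    by (rule sum.cong) auto
  then show "(\<Sum>k<CARD('n). (if i = k then real i - (real CARD('n) - 1) / 2 else 0) * f k j)
    = (real i - (real CARD('n) - 1) / 2) * f i j" using i by simp
qed

lemma ctranspose_ctranspose [simp]: "ctranspose (ctranspose A) = A"
  by (simp add: ctranspose_def vec_eq_iff)

lemma ctranspose_mult: "ctranspose (A ** B) = ctranspose B ** ctranspose A"
  by (simp add: ctranspose_def matrix_matrix_mult_def vec_eq_iff mult.commute)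

text \<open>
  Carries the formulas for left multiplication over to right multiplication.
\<close>

lemma mult_right_ctranspose: "A ** B = ctranspose (ctranspose B ** ctranspose A)"
  by (simp add: ctranspose_mult)

lemma ctranspose_spin_diag: "ctranspose spin_diag = spin_diag"
  unfolding spin_diag_def ctranspose_entries by (rule entries_cong) simp

lemma shift_up_right:
  "(entries f :: 'n::{finite,linorder} cmat) ** ctranspose spin_shift
    = entries (\<lambda>i j. shift_weight CARD('n) j * f i (Suc j))"
  by (subst mult_right_ctranspose) (simp add: ctranspose_entries shift_up_left)

lemma shift_down_right:
  "(entries f :: 'n::{finite,linorder} cmat) ** spin_shift
    = entries (\<lambda>i j. if j = 0 then 0 else shift_weight CARD('n) (j - 1) * f i (j - 1))"
  by (subst mult_right_ctranspose) (simp add: ctranspose_entries shift_down_left)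

lemma diag_right:
  "(entries f :: 'n::{finite,linorder} cmat) ** spin_diag
    = entries (\<lambda>i j. (real j - (real CARD('n) - 1) / 2) * f i j)"
  by (subst mult_right_ctranspose) (simp add: ctranspose_entries ctranspose_spin_diag diag_left)

lemma casimir_op_entries:
  "casimir_op (entries f :: 'n::{finite,linorder} cmat) = entries (\<lambda>i j.
     2 * (real i - (real CARD('n) - 1) / 2) * (real j - (real CARD('n) - 1) / 2) * f i j
     + shift_weight CARD('n) i * shift_weight CARD('n) j * f (Suc i) (Suc j)
     + (if i = 0 \<or> j = 0 then 0 else
         shift_weight CARD('n) (i - 1) * shift_weight CARD('n) (j - 1) * f (i - 1) (j - 1))
     - ((real CARD('n))\<^sup>2 - 1) / 2 * f i j)"
  unfolding casimir_op_def diag_left diag_right shift_up_left shift_up_right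
    shift_down_left shift_down_right entries_scaleR entries_add
  by (rule entries_cong) (simp add: algebra_simps diff_divide_distrib)

text \<open>
  The square root is the one that Racah's formula contributes for each of the two magnetic
  quantum numbers of row and column.
\<close>

definition hahn_norm :: "nat \<Rightarrow> nat \<Rightarrow> real" where
  "hahn_norm N i = sqrt (fact i * fact (N - 1 - i))"

definition hahn_mat :: "nat \<Rightarrow> int \<Rightarrow> ('n::{finite,linorder}) cmat" where
  "hahn_mat l m = entries (\<lambda>i j. if int i - int j = m
     then hahn_norm CARD('n) i * hahn_norm CARD('n) j * hahn l (CARD('n) - 1 - l) i j else 0)"

text \<open>
  The norming factors absorb the square roots of the ladder coefficients, so that after
  normalization the operator \<open>casimir_op\<close> acts with rational coefficients.
\<close>

lemma shift_weight_hahn_norm: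
  assumes "Suc i < N"
  shows "shift_weight N i * hahn_norm N (Suc i) = (real i + 1) * hahn_norm N i"
    and "shift_weight N i * hahn_norm N i = (real N - 1 - real i) * hahn_norm N (Suc i)"
proof -
  obtain k where k: "N = Suc (Suc (i + k))" using assms less_iff_Suc_add by auto
  have f: "fact (Suc i) = (real i + 1) * fact i" "fact (Suc k) = (real k + 1) * fact k" by simp_all
  have s: "sqrt (a * b) = sqrt a * sqrt b" for a b by (rule real_sqrt_mult)
  have q: "sqrt (real i + 1) * sqrt (real i + 1) = real i + 1" "sqrt (real k + 1) * sqrt (real k + 1) = real k + 1"
    by simp_all
  have w: "shift_weight N i = sqrt (real i + 1) * sqrt (real k + 1)"
    by (simp add: k shift_weight_def s add.commute)
  have h1: "hahn_norm N (Suc i) = sqrt (real i + 1) * sqrt (fact i) * sqrt (fact k)"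
    by (simp add: hahn_norm_def k f s del: fact_Suc of_nat_Suc)
  have "N - 1 - i = Suc k" by (simp add: k)
  then have h2: "hahn_norm N i = sqrt (fact i) * sqrt (real k + 1) * sqrt (fact k)"
    by (simp add: hahn_norm_def f s del: fact_Suc of_nat_Suc)
  have r: "real N - 1 - real i = real k + 1" by (simp add: k)
  show "shift_weight N i * hahn_norm N (Suc i) = (real i + 1) * hahn_norm N i"
    unfolding w h1 h2 by (subst (3) q(1)[symmetric]) (simp only: mult_ac)
  show "shift_weight N i * hahn_norm N i = (real N - 1 - real i) * hahn_norm N (Suc i)"
    unfolding w h1 h2 r by (subst (3) q(2)[symmetric]) (simp only: mult_ac)
qed

section \<open>The basis matrices as eigenvectors\<close>

text \<open>
  After cancellation of the norming factors, this is the difference equation of \<open>hahn\<close>. At the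
  upper boundary the ladder coefficient vanishes, in agreement with \<open>hahn\<close> being zero beyond it.
\<close>

lemma casimir_op_hahn_mat:
  assumes l: "l < CARD('n)"
  shows "casimir_op (hahn_mat l m :: 'n::{finite,linorder} cmat) = (- (real l * (real l + 1))) *\<^sub>R hahn_mat l m"
  unfolding hahn_mat_def casimir_op_entries entries_scaleR
proof (rule entries_cong, goal_cases)
  case (1 i j)
  define N where "N = CARD('n)"
  define b where "b = N - 1 - l"
  have n: "real (l + b) = real N - 1" using l by (simp add: b_def N_def of_nat_diff)
  have lb: "l + b = N - 1" using l by (simp add: b_def N_def)
  note ij = 1[folded N_def]
  show ?case
  proof (cases "int i - int j = m")
    case False
    then have "int (i - 1) - int (j - 1) \<noteq> m" if "0 < i" "0 < j" using that by (simp add: of_nat_diff)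
    with False show ?thesis by auto
  next
    case True
    let ?w = "hahn_norm N" and ?a = "shift_weight N" and ?F = "hahn l b"
    have up: "?a i * ?a j * (?w (Suc i) * ?w (Suc j) * ?F (Suc i) (Suc j))
       = ?w i * ?w j * ((real i + 1) * (real j + 1) * ?F (Suc i) (Suc j))"
    proof (cases "Suc i < N \<and> Suc j < N")
      case True
      have "?a i * ?a j * (?w (Suc i) * ?w (Suc j) * ?F (Suc i) (Suc j))
        = (?a i * ?w (Suc i)) * (?a j * ?w (Suc j)) * ?F (Suc i) (Suc j)" by (simp only: mult_ac)
      also have "\<dots> = ((real i + 1) * ?w i) * ((real j + 1) * ?w j) * ?F (Suc i) (Suc j)"
        using True by (simp only: shift_weight_hahn_norm)
      finally show ?thesis by (simp only: mult_ac)
    next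
      case False
      then have "?F (Suc i) (Suc j) = 0" by (intro hahn_eq_0) (use lb in auto)
      then show ?thesis by simp
    qed
    have diff: "2 * (real i - (real N - 1) / 2) * (real j - (real N - 1) / 2) - ((real N)\<^sup>2 - 1) / 2
       = - ((real N - 1) * (1 + real i + real j) - 2 * real i * real j)"
      by (simp add: field_simps power2_eq_square)
    show ?thesis
    proof (cases "i = 0 \<or> j = 0")
      case edge: True
      have "2 * (real i - (real N - 1) / 2) * (real j - (real N - 1) / 2) * (?w i * ?w j * ?F i j)
          + ?a i * ?a j * (?w (Suc i) * ?w (Suc j) * ?F (Suc i) (Suc j))
          - ((real N)\<^sup>2 - 1) / 2 * (?w i * ?w j * ?F i j)
        = ?w i * ?w j * ((2 * (real i - (real N - 1) / 2) * (real j - (real N - 1) / 2) - ((real N)\<^sup>2 - 1) / 2) * ?F i j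
          + (real i + 1) * (real j + 1) * ?F (Suc i) (Suc j))"
        unfolding up by (simp only: algebra_simps)
      also have "\<dots> = - (real l * (real l + 1)) * (?w i * ?w j * ?F i j)"
        unfolding diff hahn_difference_edge[OF edge] n by (simp add: algebra_simps)
      finally show ?thesis using True edge by (auto simp: N_def b_def)
    next
      case False
      then obtain i' j' where s: "i = Suc i'" "j = Suc j'" by (meson not0_implies_Suc)
      have down: "?a i' * ?a j' * (?w i' * ?w j' * ?F i' j')
         = ?w i * ?w j * ((real N - 1 - real i') * (real N - 1 - real j') * ?F i' j')"
      proof -
        have "?a i' * ?a j' * (?w i' * ?w j' * ?F i' j') = (?a i' * ?w i') * (?a j' * ?w j') * ?F i' j'"
          by (simp only: mult_ac)
        also have "\<dots> = ((real N - 1 - real i') * ?w i) * ((real N - 1 - real j') * ?w j) * ?F i' j'"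
          using ij unfolding s by (simp only: shift_weight_hahn_norm)
        finally show ?thesis by (simp only: mult_ac)
      qed
      have "2 * (real i - (real N - 1) / 2) * (real j - (real N - 1) / 2) * (?w i * ?w j * ?F i j)
          + ?a i * ?a j * (?w (Suc i) * ?w (Suc j) * ?F (Suc i) (Suc j))
          + ?a i' * ?a j' * (?w i' * ?w j' * ?F i' j')
          - ((real N)\<^sup>2 - 1) / 2 * (?w i * ?w j * ?F i j)
        = ?w i * ?w j * ((2 * (real i - (real N - 1) / 2) * (real j - (real N - 1) / 2) - ((real N)\<^sup>2 - 1) / 2) * ?F i j
          + ((real i + 1) * (real j + 1) * ?F (Suc i) (Suc j)
             + (real N - 1 - real i') * (real N - 1 - real j') * ?F i' j'))"
        unfolding up down by (simp only: algebra_simps)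
      also have "(real i + 1) * (real j + 1) * ?F (Suc i) (Suc j)
             + (real N - 1 - real i') * (real N - 1 - real j') * ?F i' j'
          = ((real N - 1) * (1 + real i + real j) - 2 * real i * real j - real l * (real l + 1)) * ?F i j"
        using hahn_difference[of i' j' l b] unfolding n s by (simp add: algebra_simps)
      also have "?w i * ?w j * ((2 * (real i - (real N - 1) / 2) * (real j - (real N - 1) / 2) - ((real N)\<^sup>2 - 1) / 2) * ?F i j
          + ((real N - 1) * (1 + real i + real j) - 2 * real i * real j - real l * (real l + 1)) * ?F i j)
         = - (real l * (real l + 1)) * (?w i * ?w j * ?F i j)"
        unfolding diff by (simp add: algebra_simps)
      finally show ?thesis using True False by (simp add: N_def b_def s)
    qed
  qed
qed

lemma alt_sign_of_int: "alt_sign (of_int z) = (if even z then 1 else - 1)"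
  by (simp add: alt_sign_def power_int_minus_left)

text \<open>
  The factor \<open>c\<close> depends on \<open>l\<close> and \<open>m\<close> only: the product of the sign in the definition of
  \<open>T_mat\<close> and the sign of Racah's formula has the parity of \<open>l + i + j\<close>, which on the
  diagonal \<open>i - j = m\<close> is the parity of \<open>l + m\<close>.
\<close>

lemma T_mat_hahn_mat:
  assumes l: "l < CARD('n)" and m: "- int l \<le> m" "m \<le> int l"
  shows "\<exists>c. c \<noteq> 0 \<and> (T_mat l m :: 'n::{finite,linorder} cmat) = c *\<^sub>R hahn_mat l m"
proof -
  define n where "n = CARD('n) - 1"
  have N: "CARD('n) = Suc n" using l by (simp add: n_def)
  define c1 where "c1 = sqrt (real CARD('n) / (4 * pi)) * sqrt (2 * real l + 1)
      * sqrt (fact l * fact (n - l) * fact l / fact (n + l + 1))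
      * sqrt (rfact (real l + of_int m) * rfact (real l - of_int m)) / (fact (n - l) * fact l * fact l)"
  define c where "c = (if even (int l + m) then 1 else - 1) * c1"
  have "c1 \<noteq> 0" unfolding c1_def rfact_def by simp
  then have c: "c \<noteq> 0" by (simp add: c_def)
  have spin: "spin CARD('n) = real n / 2" by (simp add: spin_def N)
  have weight: "weight i = real (idx i) - real n / 2" for i :: 'n
    by (simp add: weight_def spin pos_eq_Suc_idx)
  have le: "idx i \<le> n" for i :: 'n using idx_less[of i] by (simp add: N)
  have "sqrt (real CARD('n) / (4 * pi)) * alt_sign (spin CARD('n) - weight i) * sqrt (2 * real l + 1)
      * wigner3j (spin CARD('n)) (real l) (spin CARD('n)) (- weight i) (of_int m) (weight j)
    = c * (if int (idx i) - int (idx j) = m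
     then hahn_norm CARD('n) (idx i) * hahn_norm CARD('n) (idx j) * hahn l (CARD('n) - 1 - l) (idx i) (idx j) else 0)"
    (is "?L = c * ?R") for i j :: 'n
  proof (cases "int (idx i) - int (idx j) = m")
    case False
    have "- weight i + of_int m + weight j \<noteq> 0"
    proof
      assume "- weight i + of_int m + weight j = 0"
      then have "of_int (int (idx i) - int (idx j)) = (of_int m :: real)" unfolding weight by simp
      then show False using False by (simp only: of_int_eq_iff)
    qed
    then show ?thesis using False by (simp add: wigner3j_eq_0)
  next
    case True
    let ?I = "idx i" and ?J = "idx j"
    have "spin CARD('n) - weight i = of_int (int n - int ?I)" by (simp add: spin weight)
    then have s1: "alt_sign (spin CARD('n) - weight i) = (if even (int n - int ?I) then 1 else - 1)"
      by (simp only: alt_sign_of_int)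
    have "real n - real l - real ?J = of_int (int n - int l - int ?J)" by simp
    then have s2: "alt_sign (real n - real l - real ?J) = (if even (int n - int l - int ?J) then 1 else - 1)"
      by (simp only: alt_sign_of_int)
    have sgn: "alt_sign (spin CARD('n) - weight i) * alt_sign (real n - real l - real ?J)
        = (if even (int l + m) then 1 else - 1)"
      unfolding s1 s2 True[symmetric] by auto
    have w: "- weight i = real n / 2 - real ?I" by (simp add: weight)
    have root: "sqrt (fact (n - ?I) * fact ?I * rfact (real l + of_int m) * rfact (real l - of_int m) * fact ?J * fact (n - ?J))
       = sqrt (rfact (real l + of_int m) * rfact (real l - of_int m)) * (hahn_norm CARD('n) ?I * hahn_norm CARD('n) ?J)"
      unfolding hahn_norm_def N by (simp add: real_sqrt_mult mult_ac)
    have "?L = sqrt (real CARD('n) / (4 * pi)) * sqrt (2 * real l + 1)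
       * (alt_sign (spin CARD('n) - weight i)
         * wigner3j (real n / 2) (real l) (real n / 2) (real n / 2 - real ?I) (of_int m) (real ?J - real n / 2))"
      unfolding w unfolding spin weight by (simp only: mult_ac)
    also have "wigner3j (real n / 2) (real l) (real n / 2) (real n / 2 - real ?I) (of_int m) (real ?J - real n / 2)
      = alt_sign (real n - real l - real ?J)
      * sqrt (fact l * fact (n - l) * fact l / fact (n + l + 1))
      * (sqrt (rfact (real l + of_int m) * rfact (real l - of_int m)) * (hahn_norm CARD('n) ?I * hahn_norm CARD('n) ?J))
      * (hahn l (n - l) ?I ?J / (fact (n - l) * fact l * fact l))"
      using wigner3j_hahn[OF le le _ m True[symmetric]] l unfolding root by (simp add: N)
    also have "sqrt (real CARD('n) / (4 * pi)) * sqrt (2 * real l + 1) * (alt_sign (spin CARD('n) - weight i) * (\<dots>))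
       = (alt_sign (spin CARD('n) - weight i) * alt_sign (real n - real l - real ?J))
        * c1 * (hahn_norm CARD('n) ?I * hahn_norm CARD('n) ?J * hahn l (n - l) ?I ?J)"
      unfolding c1_def times_divide_eq_left times_divide_eq_right by (simp only: mult_ac)
    also have "\<dots> = c * ?R" unfolding sgn c_def[symmetric] using True by (simp add: N)
    finally show ?thesis .
  qed
  then have "T_mat l m = (entries (\<lambda>i j. c * (if int i - int j = m
     then hahn_norm CARD('n) i * hahn_norm CARD('n) j * hahn l (CARD('n) - 1 - l) i j else 0)) :: 'n cmat)"
    unfolding T_mat_def entries_def by (simp only:)
  then show ?thesis using c unfolding hahn_mat_def entries_scaleR by blast
qed

text \<open>
  At the first entry of the \<open>m\<close>-th diagonal the sum defining \<open>hahn\<close> has one term only.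
\<close>

lemma hahn_mat_neq_0:
  assumes l: "l < CARD('n)" and m: "- int l \<le> m" "m \<le> int l"
  shows "(hahn_mat l m :: 'n::{finite,linorder} cmat) \<noteq> 0"
proof -
  define a where "a = nat m"
  define b where "b = nat (- m)"
  have ab: "a < CARD('n)" "b < CARD('n)" "a \<le> l" "b \<le> l" "int a - int b = m" "min a b = 0"
    using m l by (auto simp: a_def b_def)
  obtain i j :: 'n where ij: "idx i = a" "idx j = b" using ex_idx ab by metis
  have "hahn_norm CARD('n) k \<noteq> 0" for k by (simp add: hahn_norm_def)
  moreover have "hahn l (CARD('n) - 1 - l) a b \<noteq> 0"
    unfolding hahn_def ab(6) using ab by (simp add: binomial_eq_0_iff not_less)
  ultimately have "(hahn_mat l m :: 'n cmat) $ i $ j \<noteq> 0"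
    unfolding hahn_mat_def entries_def using ij ab by simp
  then show ?thesis by auto
qed

lemma hahn_mat_0_0: "\<exists>c. (hahn_mat 0 0 :: 'n::{finite,linorder} cmat) = c *\<^sub>R mat 1"
proof
  define N where "N = CARD('n)"
  have d: "hahn 0 (N - 1) i i * (hahn_norm N i * hahn_norm N i) = fact (N - 1)" if "i < N" for i
  proof -
    have "hahn 0 (N - 1) i i = (\<Sum>p\<in>{i}. (- 1) ^ (i - p) * real ((N - 1) choose p)
        * real (0 choose (i - p)) * real (0 choose (i - p)))"
      unfolding hahn_def by (rule sum.mono_neutral_right) (auto simp: binomial_eq_0)
    then have "hahn 0 (N - 1) i i = real ((N - 1) choose i)" by simp
    also have "\<dots> = fact (N - 1) / (fact i * fact (N - 1 - i))" using that by (intro binomial_fact) simp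
    finally show ?thesis by (simp add: hahn_norm_def)
  qed
  have one: "(mat 1 :: 'n cmat) = entries (\<lambda>i j. if i = j then 1 else 0)"
    by (simp add: mat_def entries_def vec_eq_iff)
  show "(hahn_mat 0 0 :: 'n cmat) = fact (CARD('n) - 1) *\<^sub>R mat 1"
    unfolding hahn_mat_def one entries_scaleR
    using d by (intro entries_cong) (auto simp: N_def mult_ac)
qed

section \<open>Complex matrix algebra, completeness and the Laplacian\<close>

lemma cscale_of_real: "cscale (complex_of_real r) A = r *\<^sub>R A"
  unfolding cscale_def by (simp add: vec_eq_iff) (simp add: scaleR_conv_of_real)

lemma vector_space_cscale: "vector_space (cscale :: complex \<Rightarrow> 'n::finite cmat \<Rightarrow> 'n cmat)"
  by unfold_locales (simp_all add: cscale_def vec_eq_iff algebra_simps)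

lemma linear_cscaleI:
  fixes f :: "'n::finite cmat \<Rightarrow> 'n cmat"
  assumes "\<And>x y. f (x + y) = f x + f y" and "\<And>c x. f (cscale c x) = cscale c (f x)"
  shows "Vector_Spaces.linear cscale cscale f"
  unfolding Vector_Spaces.linear_iff using assms vector_space_cscale by blast

lemma bounded_linear_of_cscale:
  fixes f :: "'n::finite cmat \<Rightarrow> 'n cmat"
  assumes "Vector_Spaces.linear cscale cscale f"
  shows "bounded_linear f"
proof -
  interpret Vector_Spaces.linear cscale cscale f by fact
  have "linear f" by (rule linearI) (simp_all add: add scale flip: cscale_of_real)
  then show ?thesis by (simp add: linear_conv_bounded_linear)
qed

lemma bounded_bilinear_matrix_mult:
  "bounded_bilinear ((**) :: 'n::finite cmat \<Rightarrow> 'n cmat \<Rightarrow> 'n cmat)"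
  unfolding bilinear_conv_bounded_bilinear[symmetric] bilinear_def
  by (auto intro!: linearI
      simp: matrix_matrix_mult_def vec_eq_iff algebra_simps sum.distrib scaleR_sum_right)

interpretation matmul: bounded_bilinear "(**) :: 'n::finite cmat \<Rightarrow> 'n cmat \<Rightarrow> 'n cmat"
  by (rule bounded_bilinear_matrix_mult)

lemma cscale_mult_left: "cscale c A ** B = cscale c (A ** B)"
  by (simp add: cscale_def matrix_matrix_mult_def vec_eq_iff sum_distrib_left mult_ac)

lemma cscale_mult_right: "A ** cscale c B = cscale c (A ** B)"
  by (simp add: cscale_def matrix_matrix_mult_def vec_eq_iff sum_distrib_left mult_ac)

lemma cscale_add_right: "cscale c (A + B) = cscale c A + cscale c B"
  by (simp add: cscale_def vec_eq_iff algebra_simps)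

lemma cscale_0_left: "cscale 0 A = 0"
  by (simp add: cscale_def vec_eq_iff)

lemma cscale_scaleR: "r *\<^sub>R cscale c A = cscale c (r *\<^sub>R A)"
  by (simp add: cscale_def vec_eq_iff)

lemma trace_cscale: "trace (cscale c A) = c * trace A"
  by (simp add: trace_def cscale_def sum_distrib_left)

lemma trace_scaleR: "trace (r *\<^sub>R (A :: 'n::finite cmat)) = r *\<^sub>R trace A"
  by (simp add: trace_def scaleR_sum_right)

lemma trace_ctranspose: "trace (ctranspose A) = cnj (trace A)"
  by (simp add: trace_def ctranspose_def)

lemma ctranspose_add: "ctranspose (A + B) = ctranspose A + ctranspose B"
  by (simp add: ctranspose_def vec_eq_iff)

lemma ctranspose_diff: "ctranspose (A - B) = ctranspose A - ctranspose B"
  by (simp add: ctranspose_def vec_eq_iff)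

lemma ctranspose_scaleR: "ctranspose (r *\<^sub>R A) = r *\<^sub>R ctranspose A"
  by (simp add: ctranspose_def vec_eq_iff)

lemma ctranspose_cscale: "ctranspose (cscale c A) = cscale (cnj c) (ctranspose A)"
  by (simp add: ctranspose_def cscale_def vec_eq_iff)

lemma ctranspose_mat_1: "ctranspose (mat 1) = mat 1"
  by (simp add: ctranspose_def mat_def vec_eq_iff)

lemma bounded_linear_trace: "bounded_linear (trace :: 'n::finite cmat \<Rightarrow> complex)"
  unfolding linear_conv_bounded_linear[symmetric]
  by (rule linearI) (simp_all add: trace_add trace_scaleR)

lemma bounded_linear_ctranspose: "bounded_linear (ctranspose :: 'n::finite cmat \<Rightarrow> 'n cmat)"
  unfolding linear_conv_bounded_linear[symmetric]
  by (rule linearI) (simp_all add: ctranspose_add ctranspose_scaleR)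

lemma frob_add_left: "frob (A + B) C = frob A C + frob B C"
  by (simp add: frob_def ctranspose_add matmul.add_left trace_add distrib_left)

lemma frob_add_right: "frob A (B + C) = frob A B + frob A C"
  by (simp add: frob_def matmul.add_right trace_add distrib_left)

lemma frob_cscale_right: "frob A (cscale c B) = c * frob A B"
  by (simp add: frob_def cscale_mult_right trace_cscale)

lemma frob_cscale_left: "frob (cscale c A) B = cnj c * frob A B"
  by (simp add: frob_def cscale_mult_left ctranspose_cscale trace_cscale)

lemma frob_sum_right: "frob A (\<Sum>x\<in>S. f x) = (\<Sum>x\<in>S. frob A (f x))"
proof -
  have "frob A 0 = 0" using frob_cscale_right[of A 0 0] by (simp add: cscale_def zero_vec_def)
  then show ?thesis by (induction S rule: infinite_finite_induct) (auto simp: frob_add_right)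
qed

lemma frob_mat_1: "frob (mat 1) (X :: 'n::finite cmat) = complex_of_real (4 * pi / real CARD('n)) * trace X"
  by (simp add: frob_def ctranspose_mat_1)

lemma frob_commute: "frob B A = cnj (frob A B)"
proof -
  have "trace (ctranspose B ** A) = trace (ctranspose (ctranspose A ** B))"
    by (simp add: ctranspose_mult)
  then show ?thesis by (simp add: frob_def trace_ctranspose)
qed

lemma frob_self_eq_0:
  assumes "frob (A :: 'n::finite cmat) A = 0"
  shows "A = 0"
proof -
  have "trace (ctranspose A ** A) = 0" using assms by (simp add: frob_def)
  moreover have "trace (ctranspose A ** A) = complex_of_real (\<Sum>i\<in>UNIV. \<Sum>j\<in>UNIV. (cmod (A $ j $ i))\<^sup>2)"
    by (simp add: trace_def ctranspose_def matrix_matrix_mult_def mult.commute flip: complex_norm_square)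
  ultimately have "(\<Sum>i\<in>UNIV. \<Sum>j\<in>UNIV. (cmod (A $ j $ i))\<^sup>2) = 0" by (simp only: of_real_eq_0_iff)
  then have "\<forall>i. \<forall>j. (cmod (A $ j $ i))\<^sup>2 = 0" by (simp add: sum_nonneg_eq_0_iff sum_nonneg)
  then show ?thesis by (simp add: vec_eq_iff)
qed

lemma casimir_op_add: "casimir_op (X + Y) = casimir_op X + casimir_op Y"
  by (simp add: casimir_op_def matmul.add_left matmul.add_right algebra_simps)

lemma casimir_op_cscale: "casimir_op (cscale c X) = cscale c (casimir_op X)"
  by (simp add: casimir_op_def cscale_mult_left cscale_mult_right cscale_scaleR cscale_add_right)

lemma linear_casimir_op: "Vector_Spaces.linear cscale cscale casimir_op"
  by (rule linear_cscaleI) (simp_all add: casimir_op_add casimir_op_cscale)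

lemma casimir_op_ctranspose: "casimir_op (ctranspose X) = ctranspose (casimir_op X)"
  by (simp add: casimir_op_def ctranspose_add ctranspose_scaleR ctranspose_mult
      ctranspose_spin_diag matrix_mul_assoc)

text \<open>
  Symmetry holds termwise by cyclicity of the trace: \<open>spin_diag\<close> is Hermitian, and the two
  terms with the ladder operators are exchanged.
\<close>

lemma frob_casimir_op: "frob (casimir_op X) Y = frob X (casimir_op Y)"
proof -
  have cyc: "trace (A ** B ** C ** Z) = trace (B ** (C ** Z ** A))" for A B C Z :: "'a cmat"
    by (metis matrix_mul_assoc trace_mul_sym)
  have "trace (ctranspose (casimir_op X) ** Y) = trace (ctranspose X ** casimir_op Y)"
    unfolding casimir_op_ctranspose[symmetric]
    unfolding casimir_op_def matmul.add_left matmul.add_right matmul.scaleR_left matmul.scaleR_right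
      trace_add trace_scaleR cyc by (simp add: add_ac)
  then show ?thesis by (simp add: frob_def)
qed

lemma casimir_op_T_mat:
  assumes "l < CARD('n)" "- int l \<le> m" "m \<le> int l"
  shows "casimir_op (T_mat l m :: 'n::{finite,linorder} cmat)
    = cscale (- (of_nat l * (of_nat l + 1))) (T_mat l m)"
proof -
  obtain c where c: "(T_mat l m :: 'n cmat) = c *\<^sub>R hahn_mat l m" using T_mat_hahn_mat[OF assms] by blast
  have e: "- (of_nat l * (of_nat l + 1)) = complex_of_real (- (real l * (real l + 1)))" by simp
  have "casimir_op (T_mat l m :: 'n cmat) = c *\<^sub>R casimir_op (hahn_mat l m)"
    unfolding c cscale_of_real[symmetric] casimir_op_cscale ..
  then show ?thesis
    unfolding e cscale_of_real casimir_op_hahn_mat[OF assms(1)] c by simp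
qed

lemma T_mat_neq_0:
  assumes "l < CARD('n)" "- int l \<le> m" "m \<le> int l"
  shows "(T_mat l m :: 'n::{finite,linorder} cmat) \<noteq> 0"
  using T_mat_hahn_mat[OF assms] hahn_mat_neq_0[OF assms] by auto

text \<open>
  Matrices on different diagonals have disjoint supports; on the same diagonal the eigenvalues
  of the symmetric operator \<open>casimir_op\<close> differ.
\<close>

lemma frob_T_mat:
  assumes lm: "l < CARD('n)" "- int l \<le> m" "m \<le> int l"
    and lm': "l' < CARD('n)" "- int l' \<le> m'" "m' \<le> int l'"
    and neq: "l \<noteq> l' \<or> m \<noteq> m'"
  shows "frob (T_mat l m :: 'n::{finite,linorder} cmat) (T_mat l' m') = 0"
proof (cases "m = m'")
  case False
  obtain c where c: "(T_mat l m :: 'n cmat) = c *\<^sub>R hahn_mat l m" using T_mat_hahn_mat[OF lm] by blast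
  obtain c' where c': "(T_mat l' m' :: 'n cmat) = c' *\<^sub>R hahn_mat l' m'" using T_mat_hahn_mat[OF lm'] by blast
  have "trace (ctranspose (hahn_mat l m :: 'n cmat) ** hahn_mat l' m') = 0"
    unfolding trace_def ctranspose_def matrix_matrix_mult_def hahn_mat_def entries_def
    using False by (auto intro!: sum.neutral)
  then show ?thesis
    by (simp add: frob_def c c' ctranspose_scaleR matmul.scaleR_left matmul.scaleR_right trace_scaleR)
next
  case True
  then have "l \<noteq> l'" using neq by simp
  have ev: "complex_of_nat l * (of_nat l + 1) \<noteq> of_nat l' * (of_nat l' + 1)"
  proof
    assume "complex_of_nat l * (of_nat l + 1) = of_nat l' * (of_nat l' + 1)"
    then have "of_nat (l * (l + 1)) = complex_of_nat (l' * (l' + 1))"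
      by (simp only: of_nat_mult of_nat_add of_nat_1)
    then have "l * (l + 1) = l' * (l' + 1)" by (simp only: of_nat_eq_iff)
    moreover have "strict_mono (\<lambda>l::nat. l * (l + 1))" by (rule strict_monoI_Suc) simp
    ultimately show False using \<open>l \<noteq> l'\<close> by (metis strict_mono_eq)
  qed
  have "cnj (- (of_nat l * (of_nat l + 1))) * frob (T_mat l m :: 'n cmat) (T_mat l' m')
      = - (of_nat l' * (of_nat l' + 1)) * frob (T_mat l m :: 'n cmat) (T_mat l' m')"
    using frob_casimir_op[of "T_mat l m :: 'n cmat" "T_mat l' m'"]
    unfolding casimir_op_T_mat[OF lm] casimir_op_T_mat[OF lm'] frob_cscale_left frob_cscale_right .
  then show ?thesis using ev by (simp del: mult_minus_left)
qed

text \<open>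
  The map \<open>(i, j) \<mapsto> (max i j, i - j)\<close> is a bijection from pairs of positions, counted from \<open>0\<close>, to
  the pairs \<open>(l, m)\<close> with \<open>\<bar>m\<bar> \<le> l \<le> N - 1\<close>. Indexing the family by matrix positions makes the
  coefficients a matrix again, and completeness becomes the surjectivity of an injective
  endomorphism.
\<close>

definition T_basis :: "'n::{finite,linorder} \<Rightarrow> 'n \<Rightarrow> 'n cmat" where
  "T_basis i j = T_mat (max (idx i) (idx j)) (int (idx i) - int (idx j))"

lemma frob_T_basis: "frob (T_basis i j) (T_basis i' j') = 0 \<longleftrightarrow> (i, j) \<noteq> (i', j')"
proof (cases "(i, j) = (i', j')")
  case True
  have "T_basis i j \<noteq> 0" unfolding T_basis_def by (rule T_mat_neq_0) (auto simp: idx_less)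
  then show ?thesis using True frob_self_eq_0 by auto
next
  case False
  then have "max (idx i) (idx j) \<noteq> max (idx i') (idx j') \<or> int (idx i) - int (idx j) \<noteq> int (idx i') - int (idx j')"
    by (auto simp: max_def split: if_splits)
  then have "frob (T_basis i j) (T_basis i' j') = 0"
    unfolding T_basis_def by (intro frob_T_mat) (auto simp: idx_less)
  then show ?thesis using False by simp
qed

text \<open>
  Orthogonality makes the synthesis map injective, hence surjective by finite dimension.
\<close>

lemma T_basis_expansion: "\<exists>C. X = (\<Sum>p\<in>UNIV. cscale (C p) (T_basis (fst p) (snd p)))"
proof -
  define \<Phi> :: "'a cmat \<Rightarrow> 'a cmat" where
    "\<Phi> C = (\<Sum>p\<in>UNIV. cscale (C $ fst p $ snd p) (T_basis (fst p) (snd p)))" for C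
  have "linear \<Phi>"
    by (rule linearI)
      (simp_all add: \<Phi>_def cscale_def vec_eq_iff sum.distrib algebra_simps scaleR_sum_right)
  moreover have "inj \<Phi>"
    unfolding linear_injective_0[OF \<open>linear \<Phi>\<close>]
  proof (intro allI impI)
    fix C assume "\<Phi> C = 0"
    have "C $ i $ j = 0" for i j
    proof -
      have "0 = frob (T_basis i j) (\<Phi> C)" using \<open>\<Phi> C = 0\<close> frob_sum_right[of _ _ "{}"] by simp
      also have "\<dots> = (\<Sum>p\<in>UNIV. C $ fst p $ snd p * frob (T_basis i j) (T_basis (fst p) (snd p)))"
        by (simp add: \<Phi>_def frob_sum_right frob_cscale_right)
      also have "\<dots> = (\<Sum>p\<in>{(i, j)}. C $ fst p $ snd p * frob (T_basis i j) (T_basis (fst p) (snd p)))"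
        by (rule sum.mono_neutral_right) (auto simp: frob_T_basis)
      finally show ?thesis using frob_T_basis[of i j i j] by simp
    qed
    then show "C = 0" by (simp add: vec_eq_iff)
  qed
  ultimately have "surj \<Phi>" by (rule linear_injective_imp_surjective) (rule refl)
  then obtain C where "X = \<Phi> C" by (metis surjD)
  then show ?thesis unfolding \<Phi>_def by (intro exI[of _ "\<lambda>p. C $ fst p $ snd p"])
qed

text \<open>
  The description of the Laplacian by its eigenvectors determines it, because these span.
\<close>

lemma laplacian_eq_casimir_op: "(laplacian :: 'n::{finite,linorder} cmat \<Rightarrow> 'n cmat) = casimir_op"
  unfolding laplacian_def
proof (rule the_equality, intro conjI allI impI)
  show "Vector_Spaces.linear cscale cscale (casimir_op :: 'n cmat \<Rightarrow> _)" by (rule linear_casimir_op)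
  fix l m assume "l \<le> CARD('n) - 1 \<and> - int l \<le> m \<and> m \<le> int l"
  moreover have "0 < CARD('n)" by simp
  ultimately show "casimir_op (T_mat l m :: 'n cmat) = cscale (- (of_nat l * (of_nat l + 1))) (T_mat l m)"
    by (intro casimir_op_T_mat) linarith+
next
  fix L :: "'n cmat \<Rightarrow> 'n cmat"
  assume L: "Vector_Spaces.linear cscale cscale L \<and>
     (\<forall>l m. l \<le> CARD('n) - 1 \<and> - int l \<le> m \<and> m \<le> int l \<longrightarrow>
        L (T_mat l m) = cscale (- (of_nat l * (of_nat l + 1))) (T_mat l m))"
  interpret L: Vector_Spaces.linear cscale cscale L using L by simp
  interpret K: Vector_Spaces.linear cscale cscale "casimir_op :: 'n cmat \<Rightarrow> _" by (rule linear_casimir_op)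
  have basis: "L (T_basis i j) = casimir_op (T_basis i j)" for i j :: 'n
  proof -
    have lt: "max (idx i) (idx j) < CARD('n)" by (simp add: idx_less)
    then have "max (idx i) (idx j) \<le> CARD('n) - 1" by linarith
    moreover have "- int (max (idx i) (idx j)) \<le> int (idx i) - int (idx j)"
      "int (idx i) - int (idx j) \<le> int (max (idx i) (idx j))" by auto
    ultimately show ?thesis unfolding T_basis_def using L casimir_op_T_mat[OF lt] by simp
  qed
  show "L = casimir_op"
  proof
    fix X :: "'n cmat"
    obtain C where X: "X = (\<Sum>p\<in>UNIV. cscale (C p) (T_basis (fst p) (snd p)))" using T_basis_expansion by blast
    show "L X = casimir_op X" unfolding X L.sum K.sum L.scale K.scale basis ..
  qed
qed

text \<open>
  By orthogonality an element of the kernel has no components with \<open>l > 0\<close>, and \<open>T_mat 0 0\<close> is a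
  multiple of the identity.
\<close>

lemma casimir_op_eq_0:
  assumes "casimir_op X = 0"
  shows "\<exists>c. X = cscale c (mat 1)"
proof -
  interpret K: Vector_Spaces.linear cscale cscale "casimir_op :: 'a cmat \<Rightarrow> _" by (rule linear_casimir_op)
  obtain C where X: "X = (\<Sum>p\<in>UNIV. cscale (C p) (T_basis (fst p) (snd p)))" using T_basis_expansion by blast
  have fX: "frob (T_basis i j) X = C (i, j) * frob (T_basis i j) (T_basis i j)" for i j
  proof -
    have "frob (T_basis i j) X = (\<Sum>p\<in>UNIV. C p * frob (T_basis i j) (T_basis (fst p) (snd p)))"
      by (simp add: X frob_sum_right frob_cscale_right)
    also have "\<dots> = (\<Sum>p\<in>{(i, j)}. C p * frob (T_basis i j) (T_basis (fst p) (snd p)))"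
      by (rule sum.mono_neutral_right) (auto simp: frob_T_basis)
    finally show ?thesis by simp
  qed
  have C0: "C (i, j) = 0" if "max (idx i) (idx j) \<noteq> 0" for i j
  proof -
    let ?l = "max (idx i) (idx j)"
    have ev: "casimir_op (T_basis i j) = cscale (- (of_nat ?l * (of_nat ?l + 1))) (T_basis i j)"
      unfolding T_basis_def by (rule casimir_op_T_mat) (auto simp: idx_less)
    have "0 = frob (T_basis i j) (casimir_op X)"
      using assms frob_sum_right[of _ _ "{}"] by simp
    also have "\<dots> = frob (casimir_op (T_basis i j)) X" by (simp add: frob_casimir_op)
    also have "\<dots> = cnj (- (of_nat ?l * (of_nat ?l + 1))) * (C (i, j) * frob (T_basis i j) (T_basis i j))"
      unfolding ev frob_cscale_left fX ..
    finally have "cnj (- (of_nat ?l * (of_nat ?l + 1))) * (C (i, j) * frob (T_basis i j) (T_basis i j)) = 0" by simp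
    moreover have "complex_of_nat ?l \<noteq> 0" using that by (simp only: of_nat_eq_0_iff not_False_eq_True)
    moreover have "complex_of_nat ?l + 1 \<noteq> 0"
      by (metis of_nat_Suc of_nat_eq_0_iff add.commute nat.distinct(1))
    moreover have "frob (T_basis i j) (T_basis i j) \<noteq> 0" by (simp add: frob_T_basis)
    ultimately show ?thesis by (auto simp del: of_nat_max)
  qed
  obtain i0 :: 'a where i0: "idx i0 = 0" using ex_idx by (metis zero_less_card_finite)
  have "X = (\<Sum>p\<in>{(i0, i0)}. cscale (C p) (T_basis (fst p) (snd p)))"
    unfolding X
  proof (rule sum.mono_neutral_right)
    show "\<forall>p\<in>UNIV - {(i0, i0)}. cscale (C p) (T_basis (fst p) (snd p)) = 0"
    proof
      fix p assume p: "p \<in> UNIV - {(i0, i0)}"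
      have "max (idx (fst p)) (idx (snd p)) \<noteq> 0"
      proof
        assume "max (idx (fst p)) (idx (snd p)) = 0"
        then have "idx (fst p) = idx i0" "idx (snd p) = idx i0" using i0 by auto
        then have "p = (i0, i0)" by (simp add: prod_eq_iff)
        with p show False by simp
      qed
      then have "C p = 0" using C0[of "fst p" "snd p"] by simp
      then show "cscale (C p) (T_basis (fst p) (snd p)) = 0" by (simp add: cscale_def zero_vec_def)
    qed
  qed auto
  then have "X = cscale (C (i0, i0)) (T_mat 0 0)" by (simp add: T_basis_def i0)
  moreover obtain c where c: "(T_mat 0 0 :: 'a cmat) = c *\<^sub>R hahn_mat 0 0"
    using T_mat_hahn_mat[of 0 0, where 'n = 'a] by auto
  moreover obtain d where d: "(hahn_mat 0 0 :: 'a cmat) = d *\<^sub>R mat 1" using hahn_mat_0_0 by blast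
  ultimately have "X = cscale (C (i0, i0) * of_real (c * d)) (mat 1)"
    by (simp flip: cscale_of_real)
  then show ?thesis ..
qed

section \<open>The inverse Laplacian\<close>

lemma casimir_op_0: "casimir_op 0 = 0"
  by (simp add: casimir_op_def)

text \<open>
  The trace is the pairing with the identity, which is in the kernel of the symmetric operator.
\<close>

lemma trace_casimir_op: "trace (casimir_op (X :: 'n::{finite,linorder} cmat)) = 0"
proof -
  obtain c where c: "(T_mat 0 0 :: 'n cmat) = c *\<^sub>R hahn_mat 0 0" and c0: "c \<noteq> 0"
    using T_mat_hahn_mat[of 0 0, where 'n = 'n] by auto
  obtain d where d: "(hahn_mat 0 0 :: 'n cmat) = d *\<^sub>R mat 1" using hahn_mat_0_0 by blast
  have "d \<noteq> 0" using d hahn_mat_neq_0[of 0 0, where 'n = 'n] by auto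
  then have one: "(mat 1 :: 'n cmat) = cscale (of_real (inverse (c * d))) (T_mat 0 0)"
    using c c0 d by (simp add: cscale_of_real del: of_real_inverse of_real_mult inverse_mult_distrib)
  have "casimir_op (T_mat 0 0 :: 'n cmat) = 0"
    using casimir_op_T_mat[of 0 0, where 'n = 'n] by (simp add: cscale_def zero_vec_def)
  then have "casimir_op (mat 1 :: 'n cmat) = 0"
    unfolding one casimir_op_cscale by (simp add: cscale_def zero_vec_def)
  then have "frob (mat 1) (casimir_op X) = 0"
    unfolding frob_casimir_op[symmetric] by (simp add: frob_def ctranspose_def trace_def matrix_matrix_mult_def)
  then show ?thesis by (simp add: frob_mat_1)
qed

lemma casimir_op_inj_traceless:
  assumes "casimir_op X = casimir_op Y" "trace X = trace Y"
  shows "(X :: 'n::{finite,linorder} cmat) = Y"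
proof -
  interpret K: Vector_Spaces.linear cscale cscale "casimir_op :: 'n cmat \<Rightarrow> _" by (rule linear_casimir_op)
  have "casimir_op (X - Y) = 0" using assms by (simp add: K.diff)
  then obtain c where c: "X - Y = cscale c (mat 1)" using casimir_op_eq_0 by blast
  have "trace (X - Y) = 0" using assms by (simp add: trace_sub)
  then have "c = 0" unfolding c trace_cscale trace_I by simp
  then have "X - Y = 0" using c by (simp add: cscale_def zero_vec_def)
  then show ?thesis by simp
qed

definition traceless_part :: "('n::finite) cmat \<Rightarrow> 'n cmat" where
  "traceless_part X = X - cscale (trace X / of_nat CARD('n)) (mat 1)"

lemma trace_traceless_part: "trace (traceless_part X) = 0"
  by (simp add: traceless_part_def trace_sub trace_cscale trace_I)

lemma traceless_part_add: "traceless_part (X + Y) = traceless_part X + traceless_part Y"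
  by (simp add: traceless_part_def trace_add cscale_def vec_eq_iff algebra_simps add_divide_distrib)

lemma traceless_part_cscale: "traceless_part (cscale c X) = cscale c (traceless_part X)"
  unfolding traceless_part_def trace_cscale by (simp add: cscale_def vec_eq_iff algebra_simps)

lemma traceless_part_eq: "trace X = 0 \<Longrightarrow> traceless_part X = X"
  by (simp add: traceless_part_def cscale_def vec_eq_iff)

text \<open>
  Adding \<open>trace Z\<close> times the identity makes the operator injective on all matrices, hence
  surjective; the added term vanishes on the preimage of a traceless matrix.
\<close>

lemma casimir_op_onto:
  fixes X :: "'n::{finite,linorder} cmat"
  assumes "trace X = 0"
  shows "\<exists>Z. trace Z = 0 \<and> casimir_op Z = X"
proof -
  define \<Phi> :: "'n cmat \<Rightarrow> 'n cmat" where "\<Phi> Z = casimir_op Z + cscale (trace Z) (mat 1)" for Z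
  have tr: "trace (\<Phi> Z) = of_nat CARD('n) * trace Z" for Z
    by (simp add: \<Phi>_def trace_add trace_casimir_op trace_cscale trace_I)
  have lin: "linear \<Phi>"
    unfolding \<Phi>_def
    by (rule linearI) (simp_all add: casimir_op_add trace_add trace_scaleR casimir_op_cscale
        flip: cscale_of_real, simp_all add: cscale_def vec_eq_iff algebra_simps trace_def sum_distrib_left)
  have "inj \<Phi>"
    unfolding linear_injective_0[OF lin]
  proof (intro allI impI)
    fix Z assume "\<Phi> Z = 0"
    then have "trace Z = 0" using tr[of Z] by (simp add: trace_def)
    moreover have "casimir_op Z = casimir_op 0"
      using \<open>\<Phi> Z = 0\<close> \<open>trace Z = 0\<close>
      by (simp add: \<Phi>_def casimir_op_0) (simp add: cscale_def vec_eq_iff)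
    ultimately show "Z = 0" using casimir_op_inj_traceless[of Z 0] by (simp add: trace_def)
  qed
  with lin have "surj \<Phi>" by (rule linear_injective_imp_surjective) (rule refl)
  then obtain Z where Z: "\<Phi> Z = X" by (metis surjD)
  then have "trace Z = 0" using tr[of Z] assms by simp
  with Z show ?thesis by (intro exI[of _ Z]) (simp add: \<Phi>_def cscale_0_left)
qed

text \<open>
  The matrix of trace \<open>0\<close> whose Laplacian is the traceless part of \<open>X\<close> exists and is unique. It
  depends linearly on \<open>X\<close> and meets the conditions that define the inverse Laplacian; conversely
  these conditions leave no choice on traceless matrices and on the identity.
\<close>

lemma laplacian_inv_properties:
  "trace (laplacian_inv X) = 0 \<and> casimir_op (laplacian_inv X) = traceless_part (X :: 'n::{finite,linorder} cmat)
   \<and> Vector_Spaces.linear cscale cscale (laplacian_inv :: 'n cmat \<Rightarrow> 'n cmat)"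
proof -
  define spec :: "('n cmat \<Rightarrow> 'n cmat) \<Rightarrow> bool" where
    "spec M \<longleftrightarrow> Vector_Spaces.linear cscale cscale M \<and> M (mat 1) = 0 \<and>
     (\<forall>X. trace X = 0 \<longrightarrow> trace (M X) = 0 \<and> laplacian (M X) = X \<and> M (laplacian X) = X)" for M
  define M where "M X = (SOME Z. trace Z = 0 \<and> casimir_op Z = traceless_part X)" for X :: "'n cmat"
  have M: "trace (M X) = 0" "casimir_op (M X) = traceless_part X" for X
  proof -
    have "trace (M X) = 0 \<and> casimir_op (M X) = traceless_part X"
      unfolding M_def using someI_ex[OF casimir_op_onto[OF trace_traceless_part[of X]]] .
    then show "trace (M X) = 0" "casimir_op (M X) = traceless_part X" by auto
  qed
  have M_eq: "M X = Z" if "trace Z = 0" "casimir_op Z = traceless_part X" for X Z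
    by (rule casimir_op_inj_traceless) (simp_all add: that M)
  have "spec M"
    unfolding spec_def laplacian_eq_casimir_op
  proof (intro conjI allI impI)
    show "Vector_Spaces.linear cscale cscale M"
    proof (rule linear_cscaleI)
      fix X Y c
      show "M (X + Y) = M X + M Y"
        by (rule M_eq) (simp_all add: trace_add M casimir_op_add traceless_part_add)
      show "M (cscale c X) = cscale c (M X)"
        by (rule M_eq) (simp_all add: trace_cscale M casimir_op_cscale traceless_part_cscale)
    qed
    show "M (mat 1) = 0"
    proof (rule M_eq)
      show "casimir_op 0 = traceless_part (mat 1)"
        by (simp add: traceless_part_def trace_I casimir_op_0) (simp add: cscale_def vec_eq_iff)
    qed (simp add: trace_def)
    fix X :: "'n cmat" assume X: "trace X = 0"
    show "trace (M X) = 0" "casimir_op (M X) = X" using M X by (simp_all add: traceless_part_eq)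
    show "M (casimir_op X) = X"
      by (rule M_eq) (simp_all add: X traceless_part_eq trace_casimir_op)
  qed
  moreover have "M' = M" if "spec M'" for M'
  proof
    fix X
    interpret M': Vector_Spaces.linear cscale cscale M' using that by (simp add: spec_def)
    have one: "M' (mat 1) = 0" and M': "\<And>X. trace X = 0 \<Longrightarrow> trace (M' X) = 0 \<and> casimir_op (M' X) = X"
      using that unfolding spec_def laplacian_eq_casimir_op by auto
    have "M' X = M' (traceless_part X) + cscale (trace X / of_nat CARD('n)) (M' (mat 1))"
      unfolding M'.scale[symmetric] M'.add[symmetric] by (simp add: traceless_part_def)
    also have "\<dots> = M' (traceless_part X)" by (simp add: one cscale_def vec_eq_iff)
    finally have "M' X = M' (traceless_part X)" .
    then show "M' X = M X" using M'[OF trace_traceless_part] by (metis M_eq)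
  qed
  ultimately have "laplacian_inv = M"
    unfolding laplacian_inv_def spec_def[symmetric] by (rule the_equality)
  moreover have "Vector_Spaces.linear cscale cscale M" using \<open>spec M\<close> by (simp add: spec_def)
  ultimately show ?thesis using M by simp
qed

lemmas trace_laplacian_inv = laplacian_inv_properties[THEN conjunct1]
lemmas casimir_op_laplacian_inv = laplacian_inv_properties[THEN conjunct2, THEN conjunct1]
lemmas linear_laplacian_inv = laplacian_inv_properties[THEN conjunct2, THEN conjunct2]

lemma bounded_linear_laplacian_inv:
  "bounded_linear (laplacian_inv :: 'n::{finite,linorder} cmat \<Rightarrow> 'n cmat)"
  by (rule bounded_linear_of_cscale[OF linear_laplacian_inv])

lemma laplacian_inv_ctranspose: "laplacian_inv (ctranspose X) = ctranspose (laplacian_inv X)"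
  by (rule casimir_op_inj_traceless)
    (simp_all add: casimir_op_ctranspose casimir_op_laplacian_inv trace_ctranspose trace_laplacian_inv,
      simp add: traceless_part_def ctranspose_diff ctranspose_cscale trace_ctranspose ctranspose_mat_1)

text \<open>
  The images of the inverse Laplacian are orthogonal to the identity, so that each argument can be
  replaced by its traceless part, which is in the image of the symmetric operator \<open>casimir_op\<close>.
\<close>

lemma frob_laplacian_inv: "frob (laplacian_inv X) Y = frob X (laplacian_inv (Y :: 'n::{finite,linorder} cmat))"
proof -
  have one: "frob (mat 1) (laplacian_inv Z) = 0" for Z :: "'n cmat"
    by (simp add: frob_mat_1 trace_laplacian_inv)
  then have one': "frob (laplacian_inv Z) (mat 1) = 0" for Z :: "'n cmat"
    using frob_commute[of "mat 1" "laplacian_inv Z"] by simp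
  have split: "Z = casimir_op (laplacian_inv Z) + cscale (trace Z / of_nat CARD('n)) (mat 1)" for Z :: "'n cmat"
    by (simp add: casimir_op_laplacian_inv traceless_part_def)
  have "frob (laplacian_inv X) Y = frob (laplacian_inv X) (casimir_op (laplacian_inv Y))"
    by (subst split[of Y]) (simp add: frob_add_right frob_cscale_right one')
  also have "\<dots> = frob (casimir_op (laplacian_inv X)) (laplacian_inv Y)" by (simp add: frob_casimir_op)
  also have "\<dots> = frob X (laplacian_inv Y)"
    by (subst (2) split[of X]) (simp add: frob_add_left frob_cscale_left one)
  finally show ?thesis .
qed

text \<open>
  The symmetry in bilinear form, as needed for differentiating \<open>trace (X ** laplacian_inv X)\<close>.
\<close>

lemma trace_laplacian_inv_mult:
  "trace (X ** laplacian_inv Y) = trace (laplacian_inv X ** (Y :: 'n::{finite,linorder} cmat))"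
  using frob_laplacian_inv[of "ctranspose X" Y] by (simp add: frob_def laplacian_inv_ctranspose)

lemma skew_hermitian_iff: "X \<in> skew_hermitian \<longleftrightarrow> ctranspose X = - X"
  by (simp add: skew_hermitian_def)

lemma ctranspose_minus: "ctranspose (- A) = - ctranspose A"
  by (simp add: ctranspose_def vec_eq_iff)

lemma laplacian_inv_skew_hermitian:
  "X \<in> skew_hermitian \<Longrightarrow> laplacian_inv X \<in> skew_hermitian"
  using linear_neg[OF bounded_linear.linear[OF bounded_linear_laplacian_inv], of X]
  by (simp add: skew_hermitian_iff flip: laplacian_inv_ctranspose)

section \<open>Linear differential equations\<close>

text \<open>
  Gronwall's argument: \<open>exp (- 2 K t) \<parallel>d t\<parallel>\<^sup>2\<close> is nonincreasing and vanishes at \<open>0\<close>.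
\<close>

lemma linear_ode_unique:
  fixes d :: "real \<Rightarrow> 'a::real_inner"
  assumes deriv: "\<And>t. t \<in> {0..T} \<Longrightarrow> (d has_vector_derivative d' t) (at t within {0..T})"
    and bound: "\<And>t. t \<in> {0..T} \<Longrightarrow> norm (d' t) \<le> K * norm (d t)"
    and init: "d 0 = 0" and t: "t \<in> {0..T}"
  shows "d t = 0"
proof -
  define f where "f s = exp (- (2 * K * s)) * (d s \<bullet> d s)" for s
  define f' where "f' s = exp (- (2 * K * s)) * (2 * (d s \<bullet> d' s) - 2 * K * (d s \<bullet> d s))" for s
  have der: "(f has_real_derivative f' s) (at s within {0..T})" if "s \<in> {0..T}" for s
  proof -
    have "((\<lambda>s. d s \<bullet> d s) has_vector_derivative (d s \<bullet> d' s + d' s \<bullet> d s)) (at s within {0..T})"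
      by (rule bounded_bilinear.has_vector_derivative[OF bounded_bilinear_inner deriv[OF that] deriv[OF that]])
    then have i: "((\<lambda>s. d s \<bullet> d s) has_real_derivative (2 * (d s \<bullet> d' s))) (at s within {0..T})"
      by (simp add: has_real_derivative_iff_has_vector_derivative inner_commute)
    show ?thesis
      unfolding f_def f'_def
      by (rule derivative_eq_intros i refl)+ (simp add: algebra_simps)
  qed
  have nonpos: "f' s \<le> 0" if "s \<in> {0..T}" for s
  proof -
    have "d s \<bullet> d' s \<le> norm (d s) * norm (d' s)" by (rule norm_cauchy_schwarz)
    also have "\<dots> \<le> norm (d s) * (K * norm (d s))"
      by (intro mult_left_mono bound that) simp
    also have "\<dots> = K * (d s \<bullet> d s)" by (simp add: dot_square_norm power2_eq_square)
    finally show ?thesis unfolding f'_def by (intro mult_nonneg_nonpos) auto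
  qed
  have der_int: "\<exists>y. DERIV f s :> y \<and> y \<le> 0" if "0 < s" "s < t" for s
  proof (intro exI conjI)
    have "at s within {0..T} = at s" using that t by (intro at_within_Icc_at) auto
    moreover have "s \<in> {0..T}" using that t by auto
    ultimately show "DERIV f s :> f' s" using der[of s] by metis
    show "f' s \<le> 0" by (rule nonpos) (use that t in auto)
  qed
  have "continuous_on {0..T} f" by (rule DERIV_continuous_on[OF der])
  then have cont: "continuous_on {0..t} f" by (rule continuous_on_subset) (use t in auto)
  have "0 \<le> t" using t by simp
  then have "f t \<le> f 0" by (rule DERIV_nonpos_imp_decreasing_open[OF _ der_int cont])
  moreover have "f 0 = 0" unfolding f_def init by simp
  ultimately have "exp (- (2 * K * t)) * (d t \<bullet> d t) \<le> 0" unfolding f_def by linarith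
  then have "d t \<bullet> d t \<le> 0" by (simp only: mult_le_0_iff) (use exp_gt_zero[of "- (2 * K * t)"] in linarith)
  then show ?thesis by (metis inner_ge_zero inner_eq_zero_iff order_antisym)
qed

text \<open>
  Picard iteration. The successive integrals \<open>R k\<close> of the initial value are bounded by
  \<open>\<parallel>x0\<parallel> (K t)\<^sup>k / k!\<close>, so that their sum converges uniformly together with the series of
  derivatives. Since the equation is linear, this works on the whole interval at once.
\<close>

lemma linear_ode_exists:
  fixes prod :: "'a::real_normed_vector \<Rightarrow> 'b::banach \<Rightarrow> 'b" (infixl \<open>\<star>\<close> 70)
  assumes bil: "bounded_bilinear prod" and cont: "continuous_on {0..T} A" and T: "0 \<le> T"
  shows "\<exists>x. x 0 = x0 \<and> (\<forall>t\<in>{0..T}. (x has_vector_derivative A t \<star> x t) (at t within {0..T}))"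
proof -
  interpret bounded_bilinear prod by fact
  obtain B where B: "B > 0" "\<And>a b. norm (a \<star> b) \<le> norm a * norm b * B" using pos_bounded by blast
  have "bounded (A ` {0..T})"
    by (intro compact_imp_bounded compact_continuous_image cont compact_Icc)
  then obtain M where M: "M > 0" "\<And>t. t \<in> {0..T} \<Longrightarrow> norm (A t) \<le> M"
    unfolding bounded_pos by auto
  define K where "K = M * B"
  have K: "K > 0" using B M by (simp add: K_def)
  have bound: "norm (A t \<star> y) \<le> K * norm y" if "t \<in> {0..T}" for t y
  proof -
    have "norm (A t \<star> y) \<le> norm (A t) * norm y * B" by (rule B)
    also have "\<dots> \<le> M * norm y * B"
      using B M(2)[OF that] by (intro mult_right_mono) auto
    finally show ?thesis by (simp add: K_def mult_ac)
  qed
  define R where "R = rec_nat (\<lambda>_. x0) (\<lambda>_ r t. integral {0..t} (\<lambda>s. A s \<star> r s))"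
  have R0: "R 0 t = x0" for t by (simp add: R_def)
  have RS: "R (Suc k) t = integral {0..t} (\<lambda>s. A s \<star> R k s)" for k t by (simp add: R_def)
  have contR: "continuous_on {0..T} (R k)" for k
  proof (induction k)
    case 0 then show ?case by (simp add: R0)
  next
    case (Suc k)
    have "continuous_on {0..T} (\<lambda>t. integral {0..t} (\<lambda>s. A s \<star> R k s))"
      by (intro indefinite_integral_continuous_1 integrable_continuous_real continuous_on cont Suc)
    then show ?case by (simp add: RS)
  qed
  have contAR: "continuous_on {0..T} (\<lambda>s. A s \<star> R k s)" for k
    by (intro continuous_on cont contR)
  have derR: "(R (Suc k) has_vector_derivative A t \<star> R k t) (at t within {0..T})" if "t \<in> {0..T}" for k t
    using integral_has_vector_derivative[OF contAR that, of k] by (simp add: RS[abs_def])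
  have normR: "norm (R k t) \<le> norm x0 * (K * t) ^ k / fact k" if "t \<in> {0..T}" for k t
    using that
  proof (induction k arbitrary: t)
    case 0 then show ?case by (simp add: R0)
  next
    case (Suc k)
    define g where "g s = norm x0 * (K * s) ^ Suc k / fact (Suc k)" for s
    have int: "((\<lambda>s. K * (norm x0 * (K * s) ^ k / fact k)) has_integral g t - g 0) {0..t}"
    proof (rule fundamental_theorem_of_calculus)
      show "0 \<le> t" using Suc by simp
      fix s
      have "(g has_real_derivative norm x0 * (real (Suc k) * (K * s) ^ k * K) / fact (Suc k)) (at s within {0..t})"
        unfolding g_def by (rule derivative_eq_intros refl | simp)+
      moreover have "norm x0 * (real (Suc k) * (K * s) ^ k * K) / fact (Suc k)
          = K * (norm x0 * (K * s) ^ k / fact k)"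
        by (simp add: field_simps del: of_nat_Suc)
      ultimately have "(g has_real_derivative K * (norm x0 * (K * s) ^ k / fact k)) (at s within {0..t})"
        by (rule DERIV_cong)
      then show "(g has_vector_derivative K * (norm x0 * (K * s) ^ k / fact k)) (at s within {0..t})"
        by (simp only: has_real_derivative_iff_has_vector_derivative)
    qed
    have "norm (R (Suc k) t) \<le> integral {0..t} (\<lambda>s. K * (norm x0 * (K * s) ^ k / fact k))"
      unfolding RS
    proof (rule integral_norm_bound_integral)
      show "(\<lambda>s. A s \<star> R k s) integrable_on {0..t}"
        by (rule integrable_continuous_real, rule continuous_on_subset[OF contAR]) (use Suc in auto)
      show "(\<lambda>s. K * (norm x0 * (K * s) ^ k / fact k)) integrable_on {0..t}" using int by blast
      fix s assume "s \<in> {0..t}"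
      then have s: "s \<in> {0..T}" using Suc.prems by auto
      have "norm (A s \<star> R k s) \<le> K * norm (R k s)" by (rule bound[OF s])
      also have "\<dots> \<le> K * (norm x0 * (K * s) ^ k / fact k)"
        using Suc.IH[OF s] K by (intro mult_left_mono) auto
      finally show "norm (A s \<star> R k s) \<le> K * (norm x0 * (K * s) ^ k / fact k)" .
    qed
    also have "\<dots> = g t" using integral_unique[OF int] by (simp add: g_def)
    finally show ?case by (simp add: g_def)
  qed
  define C where "C k = norm x0 * (K * T) ^ k / fact k" for k
  have normC: "norm (R k t) \<le> C k" if "t \<in> {0..T}" for k t
  proof -
    have "norm x0 * (K * t) ^ k / fact k \<le> C k"
      unfolding C_def using that K by (intro divide_right_mono mult_left_mono power_mono) auto
    with normR[OF that, of k] show ?thesis by linarith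
  qed
  have sumC: "summable C"
    unfolding C_def using summable_mult[OF summable_exp, of "norm x0" "K * T"]
    by (simp add: field_simps)
  have sumR: "summable (\<lambda>k. R k t)" if "t \<in> {0..T}" for t
    by (rule summable_comparison_test'[OF sumC normC[OF that]])
  \<comment> \<open>The derivative of the k-th term; the series of derivatives is the image under A t of the
    series itself, shifted by one place.\<close>
  define V where "V k t = (case k of 0 \<Rightarrow> 0 | Suc j \<Rightarrow> A t \<star> R j t)" for k t
  have derV: "(R k has_vector_derivative V k t) (at t within {0..T})" if "t \<in> {0..T}" for k t
    using derR[OF that] by (cases k) (simp_all add: V_def R0[abs_def])
  define E where "E k = (case k of 0 \<Rightarrow> 0 | Suc j \<Rightarrow> K * C j)" for k
  have sumE: "summable E"
    using summable_mult[OF sumC, of K] summable_Suc_iff[of E] by (simp add: E_def)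
  have VE: "norm (V k t) \<le> E k" if "t \<in> {0..T}" for k t
  proof (cases k)
    case (Suc j)
    have "norm (A t \<star> R j t) \<le> K * norm (R j t)" by (rule bound[OF that])
    also have "\<dots> \<le> K * C j" using normC[OF that] K by (intro mult_left_mono) auto
    finally show ?thesis by (simp add: Suc V_def E_def)
  qed (simp add: V_def E_def)
  have unif: "uniform_limit {0..T} (\<lambda>n t. \<Sum>i<n. V i t) (\<lambda>t. \<Sum>i. V i t) sequentially"
    by (rule Weierstrass_m_test[OF VE sumE])
  have sV: "(\<Sum>i. V i t) = A t \<star> (\<Sum>i. R i t)" if "t \<in> {0..T}" for t
  proof -
    have "summable (\<lambda>i. V i t)" by (rule summable_comparison_test'[OF sumE VE[OF that]])
    then have "(\<Sum>i. V i t) = (\<Sum>i. V (Suc i) t)"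
      using suminf_split_head[of "\<lambda>i. V i t"] by (simp add: V_def)
    also have "\<dots> = (\<Sum>i. A t \<star> R i t)" by (simp add: V_def)
    also have "\<dots> = A t \<star> (\<Sum>i. R i t)"
      by (rule bounded_linear.suminf[OF bounded_linear_right sumR[OF that], symmetric])
    finally show ?thesis .
  qed
  have "\<exists>g. \<forall>t\<in>{0..T}. (\<lambda>n. R n t) sums g t \<and>
      (g has_derivative (\<lambda>h. h *\<^sub>R (\<Sum>i. V i t))) (at t within {0..T})"
  proof (rule has_derivative_series)
    show "convex {0..T}" by simp
    show "(R n has_derivative (\<lambda>h. h *\<^sub>R V n t)) (at t within {0..T})" if "t \<in> {0..T}" for n t
      using derV[OF that] by (simp add: has_vector_derivative_def)
    show "0 \<in> {0..T}" using T by simp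
    show "(\<lambda>n. R n 0) sums (\<Sum>i. R i 0)" using sumR[of 0] T by (simp add: summable_sums)
    fix e :: real assume "e > 0"
    with unif have "\<forall>\<^sub>F n in sequentially. \<forall>t\<in>{0..T}. dist (\<Sum>i<n. V i t) (\<Sum>i. V i t) < e"
      by (simp add: uniform_limit_iff)
    then show "\<forall>\<^sub>F n in sequentially. \<forall>t\<in>{0..T}. \<forall>h.
        norm ((\<Sum>i<n. h *\<^sub>R V i t) - h *\<^sub>R (\<Sum>i. V i t)) \<le> e * norm h"
    proof eventually_elim
      case (elim n)
      show ?case
      proof (intro ballI allI)
        fix t h assume "t \<in> {0..T}"
        then have "norm ((\<Sum>i<n. V i t) - (\<Sum>i. V i t)) \<le> e" using elim by (auto simp: dist_norm less_imp_le)
        then have "\<bar>h\<bar> * norm ((\<Sum>i<n. V i t) - (\<Sum>i. V i t)) \<le> \<bar>h\<bar> * e" by (rule mult_left_mono) simp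
        then show "norm ((\<Sum>i<n. h *\<^sub>R V i t) - h *\<^sub>R (\<Sum>i. V i t)) \<le> e * norm h"
          by (simp add: scaleR_sum_right[symmetric] scaleR_diff_right[symmetric] mult.commute)
      qed
    qed
  qed
  then obtain g where g: "\<And>t. t \<in> {0..T} \<Longrightarrow> (\<lambda>n. R n t) sums g t"
      "\<And>t. t \<in> {0..T} \<Longrightarrow> (g has_derivative (\<lambda>h. h *\<^sub>R (\<Sum>i. V i t))) (at t within {0..T})" by blast
  have "g 0 = (\<Sum>n. R n 0)" using g(1)[of 0] T by (simp add: sums_iff)
  also have "\<dots> = (\<Sum>n. if n = 0 then x0 else 0)"
  proof (rule arg_cong[of _ _ suminf], rule ext)
    fix n show "R n 0 = (if n = 0 then x0 else 0)" by (cases n) (simp_all add: R0 RS)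
  qed
  also have "\<dots> = x0" by (rule sums_unique[OF sums_single, symmetric])
  finally have "g 0 = x0" .
  moreover have "(g has_vector_derivative A t \<star> g t) (at t within {0..T})" if "t \<in> {0..T}" for t
    using g(2)[OF that] sV[OF that] g(1)[OF that] by (simp add: has_vector_derivative_def sums_iff)
  ultimately show ?thesis by blast
qed

section \<open>The Hamiltonian and the Zeitlin flow\<close>

text \<open>
  On skew-Hermitian matrices the sesquilinear pairing becomes bilinear. This form of the
  Hamiltonian is differentiable without reference to the subspace.
\<close>

lemma hamiltonian_skew_hermitian:
  assumes "X \<in> skew_hermitian"
  shows "hamiltonian (X :: 'n::{finite,linorder} cmat)
    = complex_of_real (2 * pi / real CARD('n)) * trace (X ** laplacian_inv X)"
proof -
  have "trace (- A) = - trace A" for A :: "'n cmat" by (simp add: trace_def sum_negf)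
  then show ?thesis using assms
    by (simp add: hamiltonian_def frob_def skew_hermitian_iff matmul.minus_left)
qed

text \<open>
  The two terms of the derivative of \<open>trace (X ** laplacian_inv X)\<close> agree by the symmetry of the
  inverse Laplacian.
\<close>

lemma hamiltonian_has_gradient:
  assumes X: "X \<in> skew_hermitian"
  shows "has_gradient hamiltonian X (- laplacian_inv (X :: 'n::{finite,linorder} cmat))"
  unfolding has_gradient_def
proof
  interpret P: bounded_linear "laplacian_inv :: 'n cmat \<Rightarrow> 'n cmat" by (rule bounded_linear_laplacian_inv)
  note PX = laplacian_inv_skew_hermitian[OF X]
  then show "- laplacian_inv X \<in> skew_hermitian"
    using ctranspose_minus[of "laplacian_inv X"] by (simp add: skew_hermitian_iff)
  define K :: "'n cmat \<Rightarrow> complex"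
    where "K Z = complex_of_real (2 * pi / real CARD('n)) * trace (Z ** laplacian_inv Z)" for Z
  define c where "c = complex_of_real (2 * pi / real CARD('n))"
  have "((\<lambda>Z. Z ** laplacian_inv Z) has_derivative (\<lambda>V. X ** laplacian_inv V + V ** laplacian_inv X))
      (at X within skew_hermitian)"
    by (rule matmul.FDERIV[OF has_derivative_ident P.has_derivative[OF has_derivative_ident]])
  then have "(K has_derivative (\<lambda>V. c * trace (X ** laplacian_inv V + V ** laplacian_inv X)))
      (at X within skew_hermitian)"
    unfolding K_def c_def
    by (intro has_derivative_mult_right bounded_linear.has_derivative[OF bounded_linear_trace])
  moreover have "c * trace (X ** laplacian_inv V + V ** laplacian_inv X) = frob (- laplacian_inv X) V" for V
  proof -
    have "ctranspose (- laplacian_inv X) = laplacian_inv X"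
      using PX ctranspose_minus[of "laplacian_inv X"] by (simp add: skew_hermitian_iff)
    moreover have "trace (X ** laplacian_inv V + V ** laplacian_inv X) = 2 * trace (laplacian_inv X ** V)"
      unfolding trace_add trace_laplacian_inv_mult[of X V] trace_mul_sym[of V] by simp
    ultimately show ?thesis by (simp add: frob_def c_def)
  qed
  ultimately have "(K has_derivative (\<lambda>V. frob (- laplacian_inv X) V)) (at X within skew_hermitian)"
    by simp
  then show "(hamiltonian has_derivative (\<lambda>V. frob (- laplacian_inv X) V)) (at X within skew_hermitian)"
    by (rule has_derivative_transform[OF X, rotated]) (simp add: K_def hamiltonian_skew_hermitian)
qed

lemma bounded_bilinear_bracket:
  "bounded_bilinear (bracket :: 'n::finite cmat \<Rightarrow> 'n cmat \<Rightarrow> 'n cmat)"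
  unfolding bilinear_conv_bounded_bilinear[symmetric] bilinear_def bracket_def
  by (auto intro!: linearI simp: matmul.add_left matmul.add_right matmul.scaleR_left matmul.scaleR_right
      algebra_simps)

lemma ctranspose_bracket:
  "ctranspose (bracket A B) = bracket (ctranspose B) (ctranspose A)"
  by (simp add: bracket_def ctranspose_scaleR ctranspose_diff ctranspose_mult)

lemma zeitlin_solution_derivative:
  assumes "zeitlin_solution T X0 X" "t \<in> {0..T}"
  shows "(X has_vector_derivative - bracket (laplacian_inv (X t)) (X t)) (at t within {0..T})"
  using assms unfolding zeitlin_solution_def by (metis eq_neg_iff_add_eq_0)

lemma zeitlin_solution_continuous:
  assumes "zeitlin_solution T X0 X"
  shows "continuous_on {0..T} X"
  using zeitlin_solution_derivative[OF assms]
  by (intro continuous_on_vector_derivative) auto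

text \<open>
  The defect \<open>D = X + X*\<close> satisfies a linear homogeneous equation along the solution with
  coefficients bounded on the compact time interval, and vanishes initially.
\<close>

lemma zeitlin_solution_skew_hermitian:
  fixes X :: "real \<Rightarrow> 'n::{finite,linorder} cmat"
  assumes sol: "zeitlin_solution T X0 X" and X0: "X0 \<in> skew_hermitian" and t: "t \<in> {0..T}"
  shows "X t \<in> skew_hermitian"
proof -
  interpret P: bounded_linear "laplacian_inv :: 'n cmat \<Rightarrow> 'n cmat" by (rule bounded_linear_laplacian_inv)
  interpret br: bounded_bilinear "bracket :: 'n cmat \<Rightarrow> 'n cmat \<Rightarrow> 'n cmat" by (rule bounded_bilinear_bracket)
  interpret ct: bounded_linear "ctranspose :: 'n cmat \<Rightarrow> 'n cmat" by (rule bounded_linear_ctranspose)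
  define D where "D s = X s + ctranspose (X s)" for s
  define D' where "D' s = - bracket (laplacian_inv (X s)) (D s) + bracket (laplacian_inv (D s)) (ctranspose (X s))" for s
  have "(D has_vector_derivative D' s) (at s within {0..T})" if s: "s \<in> {0..T}" for s
  proof -
    note d = zeitlin_solution_derivative[OF sol s]
    have "(D has_vector_derivative - bracket (laplacian_inv (X s)) (X s)
        + ctranspose (- bracket (laplacian_inv (X s)) (X s))) (at s within {0..T})"
      unfolding D_def by (intro has_vector_derivative_add d ct.has_vector_derivative)
    moreover have "bracket A B = - bracket B A" for A B :: "'n cmat"
      by (simp add: bracket_def scaleR_diff_right)
    then have "ctranspose (- bracket (laplacian_inv (X s)) (X s))
        = bracket (laplacian_inv (ctranspose (X s))) (ctranspose (X s))"
      unfolding ctranspose_minus ctranspose_bracket laplacian_inv_ctranspose by metis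
    ultimately show ?thesis
      unfolding D'_def D_def P.add br.add_left br.add_right by simp
  qed
  moreover have "\<exists>K. \<forall>s\<in>{0..T}. norm (D' s) \<le> K * norm (D s)"
  proof -
    obtain B where B: "B > 0" "\<And>a b. norm (bracket a b :: 'n cmat) \<le> norm a * norm b * B" using br.pos_bounded by blast
    obtain p where p: "p > 0" "\<And>a. norm (laplacian_inv a :: 'n cmat) \<le> norm a * p" using P.pos_bounded by blast
    obtain q where q: "q > 0" "\<And>a. norm (ctranspose a :: 'n cmat) \<le> norm a * q" using ct.pos_bounded by blast
    have "bounded (X ` {0..T})"
      by (intro compact_imp_bounded compact_continuous_image zeitlin_solution_continuous[OF sol] compact_Icc)
    then obtain M where M: "M > 0" "\<And>s. s \<in> {0..T} \<Longrightarrow> norm (X s) \<le> M"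
      unfolding bounded_pos by auto
    have "norm (D' s) \<le> (M * p * B + p * (M * q) * B) * norm (D s)" if s: "s \<in> {0..T}" for s
    proof -
      have "norm (bracket (laplacian_inv (X s)) (D s)) \<le> norm (laplacian_inv (X s)) * norm (D s) * B" by (rule B)
      also have "\<dots> \<le> (M * p) * norm (D s) * B"
        using B p M(2)[OF s] order_trans[OF p(2)[of "X s"] mult_right_mono[OF M(2)[OF s], of p]]
        by (intro mult_right_mono) auto
      finally have 1: "norm (bracket (laplacian_inv (X s)) (D s)) \<le> (M * p) * norm (D s) * B" .
      have "norm (bracket (laplacian_inv (D s)) (ctranspose (X s)))
          \<le> norm (laplacian_inv (D s)) * norm (ctranspose (X s)) * B" by (rule B)
      also have "\<dots> \<le> (norm (D s) * p) * (M * q) * B"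
        using B p q M(1) order_trans[OF q(2)[of "X s"] mult_right_mono[OF M(2)[OF s], of q]]
        by (intro mult_right_mono mult_mono p(2)) auto
      finally have 2: "norm (bracket (laplacian_inv (D s)) (ctranspose (X s))) \<le> (norm (D s) * p) * (M * q) * B" .
      have "norm (D' s) \<le> norm (bracket (laplacian_inv (X s)) (D s))
          + norm (bracket (laplacian_inv (D s)) (ctranspose (X s)))"
        unfolding D'_def by (rule norm_triangle_le) simp
      also have "\<dots> \<le> (M * p * B + p * (M * q) * B) * norm (D s)" using 1 2 by (simp add: algebra_simps)
      finally show ?thesis .
    qed
    then show ?thesis by blast
  qed
  moreover have "D 0 = 0" using sol X0 by (simp add: D_def zeitlin_solution_def skew_hermitian_iff)
  ultimately have "D t = 0" using linear_ode_unique[of T D D' _ t] t by blast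
  then show ?thesis by (simp add: D_def skew_hermitian_iff add_eq_0_iff)
qed

text \<open>
  The unitary frame \<open>R\<close> solves \<open>R' = A R\<close> with \<open>A\<close> skew-Hermitian. Both \<open>R* R\<close> and \<open>R* X R\<close> then
  have zero derivative.
\<close>

lemma zeitlin_solution_orbit:
  fixes X :: "real \<Rightarrow> 'n::{finite,linorder} cmat"
  assumes sol: "zeitlin_solution T X0 X" and X0: "X0 \<in> skew_hermitian" and t: "t \<in> {0..T}"
  shows "X t \<in> coadjoint_orbit X0"
proof -
  interpret P: bounded_linear "laplacian_inv :: 'n cmat \<Rightarrow> 'n cmat" by (rule bounded_linear_laplacian_inv)
  interpret ct: bounded_linear "ctranspose :: 'n cmat \<Rightarrow> 'n cmat" by (rule bounded_linear_ctranspose)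
  define A where "A s = (- inverse (hbar CARD('n))) *\<^sub>R laplacian_inv (X s)" for s
  have cont: "continuous_on {0..T} A"
    unfolding A_def by (intro continuous_intros P.continuous_on zeitlin_solution_continuous[OF sol])
  have "0 \<le> T" using t by simp
  then obtain R where R0: "R 0 = mat 1"
    and R: "\<And>s. s \<in> {0..T} \<Longrightarrow> (R has_vector_derivative A s ** R s) (at s within {0..T})"
    using linear_ode_exists[OF bounded_bilinear_matrix_mult cont, of "mat 1"] by blast
  have skew: "ctranspose (A s) = - A s" if "s \<in> {0..T}" for s
    using laplacian_inv_skew_hermitian[OF zeitlin_solution_skew_hermitian[OF sol X0 that]]
    by (simp add: A_def ctranspose_minus ctranspose_scaleR skew_hermitian_iff)
  have ctR: "((\<lambda>s. ctranspose (R s)) has_vector_derivative - (ctranspose (R s) ** A s)) (at s within {0..T})"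
    if "s \<in> {0..T}" for s
    using ct.has_vector_derivative[OF R[OF that]]
    by (simp add: ctranspose_mult skew[OF that] matmul.minus_right)
  have X': "(X has_vector_derivative A s ** X s - X s ** A s) (at s within {0..T})" if "s \<in> {0..T}" for s
  proof -
    have "- bracket (laplacian_inv (X s)) (X s) = A s ** X s - X s ** A s"
      unfolding A_def bracket_def by (simp add: matmul.scaleR_left matmul.scaleR_right matmul.minus_left
          matmul.minus_right scaleR_diff_right)
    then show ?thesis using zeitlin_solution_derivative[OF sol that] by simp
  qed
  have "((\<lambda>s. ctranspose (R s) ** R s) has_vector_derivative 0) (at s within {0..T})" if "s \<in> {0..T}" for s
    using matmul.has_vector_derivative[OF ctR[OF that] R[OF that]]
    by (simp add: matmul.minus_left matrix_mul_assoc)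
  then obtain G where "\<And>s. s \<in> {0..T} \<Longrightarrow> ctranspose (R s) ** R s = G"
    using has_vector_derivative_zero_constant[of "{0..T}" "\<lambda>s. ctranspose (R s) ** R s"] by auto
  from this[OF t] this[of 0] have RR: "ctranspose (R t) ** R t = mat 1"
    using \<open>0 \<le> T\<close> by (simp add: R0 ctranspose_mat_1)
  then have RR': "R t ** ctranspose (R t) = mat 1" by (simp add: matrix_left_right_inverse)
  have "((\<lambda>s. ctranspose (R s) ** (X s ** R s)) has_vector_derivative 0) (at s within {0..T})" if "s \<in> {0..T}" for s
    using matmul.has_vector_derivative[OF ctR[OF that] matmul.has_vector_derivative[OF X'[OF that] R[OF that]]]
    by (simp add: matmul.minus_left matmul.diff_left matmul.diff_right matmul.add_right matrix_mul_assoc)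
  then obtain Q where "\<And>s. s \<in> {0..T} \<Longrightarrow> ctranspose (R s) ** (X s ** R s) = Q"
    using has_vector_derivative_zero_constant[of "{0..T}" "\<lambda>s. ctranspose (R s) ** (X s ** R s)"] by auto
  from this[OF t] this[of 0] have Q: "ctranspose (R t) ** (X t ** R t) = X0"
    using \<open>0 \<le> T\<close> sol by (simp add: R0 ctranspose_mat_1 zeitlin_solution_def)
  have "R t ** X0 ** ctranspose (R t) = (R t ** ctranspose (R t)) ** X t ** (R t ** ctranspose (R t))"
    unfolding Q[symmetric] by (simp only: matrix_mul_assoc)
  then have "X t = R t ** X0 ** ctranspose (R t)" by (simp add: RR')
  then show ?thesis using RR RR' unfolding coadjoint_orbit_def unitary_def by blast
qed

text \<open>
  By symmetry of the inverse Laplacian \<open>P\<close>, the derivative of \<open>trace (X P(X))\<close> is twice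
  \<open>trace (X' P(X))\<close>, a multiple of \<open>trace ([P(X), X] P(X))\<close>, which is zero by cyclicity.
\<close>

lemma zeitlin_solution_hamiltonian:
  fixes X :: "real \<Rightarrow> 'n::{finite,linorder} cmat"
  assumes sol: "zeitlin_solution T X0 X" and X0: "X0 \<in> skew_hermitian" and t: "t \<in> {0..T}"
  shows "hamiltonian (X t) = hamiltonian X0"
proof -
  interpret P: bounded_linear "laplacian_inv :: 'n cmat \<Rightarrow> 'n cmat" by (rule bounded_linear_laplacian_inv)
  have "((\<lambda>s. trace (X s ** laplacian_inv (X s))) has_vector_derivative 0) (at s within {0..T})"
    if s: "s \<in> {0..T}" for s
  proof -
    let ?X = "X s" and ?P = "laplacian_inv (X s)" and ?X' = "- bracket (laplacian_inv (X s)) (X s)"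
    note d = zeitlin_solution_derivative[OF sol s]
    have "((\<lambda>s. trace (X s ** laplacian_inv (X s))) has_vector_derivative
        trace (?X ** laplacian_inv ?X' + ?X' ** ?P)) (at s within {0..T})"
      by (rule bounded_linear.has_vector_derivative[OF bounded_linear_trace
          matmul.has_vector_derivative[OF d P.has_vector_derivative[OF d]]])
    moreover have "trace (?X' ** ?P) = 0"
    proof -
      have "trace (?P ** ?X ** ?P) = trace (?X ** ?P ** ?P)"
        by (metis matrix_mul_assoc trace_mul_sym)
      then show ?thesis
        by (simp add: bracket_def matmul.minus_left[symmetric] matmul.scaleR_left matmul.diff_left
            trace_scaleR trace_sub flip: scaleR_minus_right)
    qed
    ultimately show ?thesis
      unfolding trace_add trace_laplacian_inv_mult[of ?X ?X'] trace_mul_sym[of ?P ?X'] by simp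
  qed
  then obtain G where "\<And>s. s \<in> {0..T} \<Longrightarrow> trace (X s ** laplacian_inv (X s)) = G"
    using has_vector_derivative_zero_constant[of "{0..T}" "\<lambda>s. trace (X s ** laplacian_inv (X s))"] by auto
  from this[OF t] this[of 0] have "trace (X t ** laplacian_inv (X t)) = trace (X0 ** laplacian_inv X0)"
    using t sol by (simp add: zeitlin_solution_def)
  then show ?thesis
    using X0 zeitlin_solution_skew_hermitian[OF sol X0 t] by (simp add: hamiltonian_skew_hermitian)
qed

section \<open>Unitary conjugation and spectral truncation\<close>

lemma matpow_conjugate:
  assumes "unitary R"
  shows "matpow (R ** X ** ctranspose R) k = R ** matpow X k ** ctranspose R"
proof (induction k)
  case 0
  then show ?case using assms by (simp add: unitary_def)
next
  case (Suc k)
  have "matpow (R ** X ** ctranspose R) (Suc k) = R ** X ** (ctranspose R ** R) ** matpow X k ** ctranspose R"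
    by (simp only: matpow.simps Suc matrix_mul_assoc)
  also have "\<dots> = R ** X ** matpow X k ** ctranspose R"
    using assms by (simp add: unitary_def)
  finally show ?case by (simp add: matrix_mul_assoc)
qed

lemma trace_conjugate: "unitary R \<Longrightarrow> trace (R ** X ** ctranspose R) = trace X"
  by (metis matrix_mul_assoc matrix_mul_lid trace_mul_sym unitary_def)

lemma casimir_coadjoint_orbit: "X \<in> coadjoint_orbit Y \<Longrightarrow> casimir k X = casimir k Y"
  by (auto simp: coadjoint_orbit_def casimir_def matpow_conjugate trace_conjugate)

lemma spectrum_conjugate_subset:
  assumes R: "unitary R"
  shows "spectrum (R ** X ** ctranspose R) \<subseteq> spectrum X"
proof
  fix z assume "z \<in> spectrum (R ** X ** ctranspose R)"
  then obtain v where v: "v \<noteq> 0" "(R ** X ** ctranspose R) *v v = z *s v" by (auto simp: spectrum_def)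
  have "R *v (ctranspose R *v v) = v" using R by (simp add: matrix_vector_mul_assoc unitary_def)
  with v have "ctranspose R *v v \<noteq> 0" by auto
  moreover have "X *v (ctranspose R *v v) = z *s (ctranspose R *v v)"
  proof -
    have "X *v (ctranspose R *v v) = (ctranspose R ** R) *v (X *v (ctranspose R *v v))"
      using R by (simp add: unitary_def)
    also have "\<dots> = ctranspose R *v ((R ** X ** ctranspose R) *v v)"
      by (simp add: matrix_vector_mul_assoc matrix_mul_assoc)
    finally show ?thesis by (simp add: v(2) vector_scalar_commute)
  qed
  ultimately show "z \<in> spectrum X" by (auto simp: spectrum_def)
qed

lemma spectrum_coadjoint_orbit:
  assumes "X \<in> coadjoint_orbit Y"
  shows "spectrum X = spectrum Y"
proof -
  obtain R where R: "unitary R" and X: "X = R ** Y ** ctranspose R"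
    using assms by (auto simp: coadjoint_orbit_def)
  have R': "unitary (ctranspose R)" using R by (simp add: unitary_def)
  have "ctranspose R ** X ** ctranspose (ctranspose R) = (ctranspose R ** R) ** Y ** (ctranspose R ** R)"
    by (simp add: X matrix_mul_assoc)
  then have "Y = ctranspose R ** X ** ctranspose (ctranspose R)" using R by (simp add: unitary_def)
  then show ?thesis
    using spectrum_conjugate_subset[OF R, of Y] spectrum_conjugate_subset[OF R', of X] X by auto
qed

lemma matpow_diag_mat: "matpow (diag_mat d) k = diag_mat (\<lambda>j. d j ^ k)"
proof (induction k)
  case 0
  then show ?case by (simp add: diag_mat_def mat_def)
next
  case (Suc k)
  have "(\<Sum>l\<in>UNIV. (if i = l then d (pos i) else 0) * (if l = j then d (pos l) ^ k else 0))
      = (\<Sum>l\<in>UNIV. if i = l then (if i = j then d (pos i) * d (pos i) ^ k else 0) else 0)" for i j :: 'a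
    by (rule sum.cong) auto
  then show ?case by (simp add: Suc) (simp add: diag_mat_def matrix_matrix_mult_def vec_eq_iff)
qed

lemma trace_diag_mat: "trace (diag_mat d :: 'n::{finite,linorder} cmat) = (\<Sum>j = 1..CARD('n). d j)"
  unfolding trace_def diag_mat_def using sum.reindex_bij_betw[OF bij_betw_pos, of d] by simp

text \<open>
  The diagonalization of a skew-Hermitian matrix shows that all \<open>lam j\<close> are imaginary, and this
  property survives the replacement by zero.
\<close>

lemma spectral_truncation_skew_hermitian:
  assumes "spectral_truncation r lam W0 Y0" "W0 \<in> skew_hermitian"
  shows "Y0 \<in> skew_hermitian"
proof -
  obtain U where U: "unitary U" and W0: "W0 = U ** diag_mat lam ** ctranspose U"
    and Y0: "Y0 = U ** diag_mat (\<lambda>j. if j \<le> r then lam j else 0) ** ctranspose U"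
    using assms(1) by (auto simp: spectral_truncation_def)
  have diag: "diag_mat lam = ctranspose U ** W0 ** U"
  proof -
    have "ctranspose U ** W0 ** U = (ctranspose U ** U) ** diag_mat lam ** (ctranspose U ** U)"
      by (simp add: W0 matrix_mul_assoc)
    then show ?thesis using U by (simp add: unitary_def)
  qed
  have "ctranspose (diag_mat lam :: 'a cmat) = - diag_mat lam"
    using assms(2) by (simp add: diag ctranspose_mult skew_hermitian_iff matmul.minus_left
        matmul.minus_right matrix_mul_assoc)
  then have lam: "cnj (lam (pos i)) = - lam (pos i)" for i :: 'a
    by (simp add: vec_eq_iff ctranspose_def diag_mat_def) (metis (full_types))
  have "ctranspose (diag_mat (\<lambda>j. if j \<le> r then lam j else 0) :: 'a cmat)
      = - diag_mat (\<lambda>j. if j \<le> r then lam j else 0)"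
    by (auto simp: vec_eq_iff ctranspose_def diag_mat_def lam)
  then show ?thesis
    by (simp add: Y0 skew_hermitian_iff ctranspose_mult matmul.minus_left matmul.minus_right matrix_mul_assoc)
qed

text \<open>
  Both matrices are diagonalized by the same unitary matrix. The assumption \<open>1 \<le> k\<close> makes the
  powers of the annihilated eigenvalues zero.
\<close>

lemma spectral_truncation_trace:
  fixes W0 :: "'n::{finite,linorder} cmat"
  assumes "spectral_truncation r lam W0 Y0" "1 \<le> k" "r \<le> CARD('n)"
  shows "trace (matpow W0 k) - trace (matpow Y0 k) = (\<Sum>j = r + 1..CARD('n). lam j ^ k)"
proof -
  obtain U where U: "unitary U" and W0: "W0 = U ** diag_mat lam ** ctranspose U"
    and Y0: "Y0 = U ** diag_mat (\<lambda>j. if j \<le> r then lam j else 0) ** ctranspose U"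
    using assms(1) by (auto simp: spectral_truncation_def)
  have "trace (matpow W0 k) - trace (matpow Y0 k)
      = (\<Sum>j = 1..CARD('n). lam j ^ k - (if j \<le> r then lam j else 0) ^ k)"
    unfolding W0 Y0 matpow_conjugate[OF U] trace_conjugate[OF U] matpow_diag_mat trace_diag_mat
    by (simp add: sum_subtractf)
  also have "\<dots> = (\<Sum>j = r + 1..CARD('n). lam j ^ k - (if j \<le> r then lam j else 0) ^ k)"
    by (rule sum.mono_neutral_right) auto
  also have "\<dots> = (\<Sum>j = r + 1..CARD('n). lam j ^ k)"
    using assms(2) by (intro sum.cong) auto
  finally show ?thesis .
qed

section \<open>Casimir functions and energy under spectral truncation\<close>

theorem mainTheorem1:
  fixes W0 Y0 :: "('n::{finite,linorder}) cmat"
    and W Y :: "real \<Rightarrow> 'n cmat"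
    and lam :: "nat \<Rightarrow> complex"
    and r :: nat
    and T :: real
  assumes "CARD('n) \<ge> 2"
    and "W0 \<in> traceless_skew_hermitian"
    and "1 \<le> r" and "r \<le> CARD('n)"
    and "spectral_truncation r lam W0 Y0"
    and "0 \<le> T"
    and "zeitlin_solution T W0 W"
    and "zeitlin_solution T Y0 Y"
  shows "lie_poisson_on {0..T} hamiltonian Y \<and>
    isospectral_on {0..T} Y \<and>
    (\<forall>t\<in>{0..T}. Y t \<in> coadjoint_orbit Y0) \<and>
    (\<forall>t\<in>{0..T}. \<forall>k\<in>{1..CARD('n)}.
       cmod (casimir k (W t) - casimir k (Y t))
         = 4 * pi / real CARD('n) * cmod (trace (matpow W0 k) - trace (matpow Y0 k)) \<and>
       4 * pi / real CARD('n) * cmod (trace (matpow W0 k) - trace (matpow Y0 k))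
         = 4 * pi / real CARD('n) * cmod (\<Sum>j = r + 1..CARD('n). lam j ^ k)) \<and>
    (\<forall>t\<in>{0..T}. cmod (hamiltonian (W t) - hamiltonian (Y t))
                  = cmod (hamiltonian W0 - hamiltonian Y0))"
proof -
  have W0: "W0 \<in> skew_hermitian" using assms(2) by (simp add: traceless_skew_hermitian_def)
  have Y0: "Y0 \<in> skew_hermitian" by (rule spectral_truncation_skew_hermitian[OF assms(5) W0])
  note W = \<open>zeitlin_solution T W0 W\<close> and Y = \<open>zeitlin_solution T Y0 Y\<close>
  have "lie_poisson_on {0..T} hamiltonian Y"
    unfolding lie_poisson_on_def
  proof (intro conjI ballI exI[of _ "\<lambda>X. - laplacian_inv X"])
    fix t assume t: "t \<in> {0..T}"
    show "Y t \<in> skew_hermitian" by (rule zeitlin_solution_skew_hermitian[OF Y Y0 t])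
    have "ad_star (- laplacian_inv (Y t)) (Y t) = bracket (laplacian_inv (Y t)) (Y t)"
      unfolding ad_star_def by (simp add: bounded_bilinear.minus_left[OF bounded_bilinear_bracket])
    then show "\<exists>Y'. (Y has_vector_derivative Y') (at t within {0..T}) \<and> Y' + ad_star (- laplacian_inv (Y t)) (Y t) = 0"
      using Y t unfolding zeitlin_solution_def by simp
  qed (rule hamiltonian_has_gradient)
  moreover have orbit: "Y t \<in> coadjoint_orbit Y0" if "t \<in> {0..T}" for t
    by (rule zeitlin_solution_orbit[OF Y Y0 that])
  moreover have "isospectral_on {0..T} Y"
    unfolding isospectral_on_def using spectrum_coadjoint_orbit[OF orbit] by simp
  moreover have "cmod (casimir k (W t) - casimir k (Y t))
         = 4 * pi / real CARD('n) * cmod (trace (matpow W0 k) - trace (matpow Y0 k))" if "t \<in> {0..T}" for t k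
  proof -
    have "casimir k (W t) - casimir k (Y t)
        = complex_of_real (4 * pi / real CARD('n)) * (trace (matpow W0 k) - trace (matpow Y0 k))"
      unfolding casimir_coadjoint_orbit[OF zeitlin_solution_orbit[OF W W0 that]]
        casimir_coadjoint_orbit[OF orbit[OF that]]
      unfolding casimir_def by (simp only: right_diff_distrib)
    then show ?thesis by (simp only: norm_mult norm_of_real) simp
  qed
  moreover have "trace (matpow W0 k) - trace (matpow Y0 k) = (\<Sum>j = r + 1..CARD('n). lam j ^ k)"
    if "k \<in> {1..CARD('n)}" for k
    using that by (intro spectral_truncation_trace[OF assms(5) _ assms(4)]) simp
  ultimately show ?thesis
    using zeitlin_solution_hamiltonian[OF W W0] zeitlin_solution_hamiltonian[OF Y Y0] by simp
qed

end
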